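(* Let $b>1$ and let $(X_n)_{n\ge 1}$ be a stationary sequence of positive random variables. Set $Y_n=\prod_{k=1}^{n}X_k$ for $n\ge 1$. Then the sequence $(Y_n)$ is almost surely Benford in base $b$ if and only if $$\forall\, h\in\mathbb{Z}^+,\quad \lim_{L\to+\infty}\frac{1}{L}\sum_{l=1}^{L}\mathbb{E}\big(e_h(\log_b Y_l)\big)=0.$$
   Context: All random variables are defined on one probability space $(\Omega,\mathcal{T},P)$. $\mathbb{Z}^+$ is the set of positive integers; $e_h(x)=\exp(2i\pi h x)$ for real $x$ and integer $h$; $\log_b$ is the logarithm in base $b$. The mantissa in base $b$ of $x>0$ is the unique $\mathcal{M}_b(x)\in[1,b[$ such that $x=\mathcal{M}_b(x)b^k$ for some integer $k$. A sequence $(u_n)$ of positive numbers is Benford in base $b$ if $\lim_{N\to+\infty}\frac1N\sum_{n=1}^N \mathbf{1}_{[1,a[}(\mathcal{M}_b(u_n))=\log_b a$ for all $1\le a<b$. A sequence $(Z_n)$ of positive random variables is almost surely Benford in base $b$ if $P(\{\omega : (Z_n(\omega)) \text{ is a Benford sequence in base } b\})=1$. Stationary means strictly stationary (finite-dimensional laws are shift-invariant). *)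

theory Defs
  imports "HOL-Probability.Probability"
begin

text \<open>Sequences are functions on \<^typ>\<open>nat\<close> of which only the terms with index at least 1 are
  used; the value at index 0 is irrelevant. The base \<open>b\<close> is any real number greater than 1.\<close>

text \<open>For \<open>b > 1\<close> and \<open>x > 0\<close> the number described here exists and is unique; for other
  arguments the value is unspecified.\<close>

definition mantissa :: "real \<Rightarrow> real \<Rightarrow> real" where
  "mantissa b x = (THE m. 1 \<le> m \<and> m < b \<and> (\<exists>k::int. x = m * b powi k))"

definition benford :: "real \<Rightarrow> (nat \<Rightarrow> real) \<Rightarrow> bool" where
  "benford b u \<longleftrightarrow>
     (\<forall>n\<ge>1. 0 < u n) \<and>
     (\<forall>a. 1 \<le> a \<and> a < b \<longrightarrow>
        (\<lambda>N. 1 / real N * (\<Sum>n=1..N. indicator {1..<a} (mantissa b (u n)))) \<longlonglongrightarrow> log b a)"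

definition as_benford :: "'a measure \<Rightarrow> real \<Rightarrow> (nat \<Rightarrow> 'a \<Rightarrow> real) \<Rightarrow> bool" where
  "as_benford M b Z \<longleftrightarrow> measure M {\<omega> \<in> space M. benford b (\<lambda>n. Z n \<omega>)} = 1"

text \<open>Strict stationarity: for every finite set \<open>I\<close> of indices, the joint law of the subfamily
  indexed by \<open>I\<close>, a measure on the finite product space, is invariant under all shifts. The
  \<open>X n\<close> are meant to be random variables, otherwise \<^const>\<open>distr\<close> is not the law.\<close>

definition stationary :: "'a measure \<Rightarrow> (nat \<Rightarrow> 'a \<Rightarrow> real) \<Rightarrow> bool" where
  "stationary M X \<longleftrightarrow>
     (\<forall>I s. finite I \<and> I \<subseteq> {1..} \<longrightarrow>
        distr M (Pi\<^sub>M I (\<lambda>_. borel)) (\<lambda>\<omega>. \<lambda>i\<in>I. X (i + s) \<omega>) =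
        distr M (Pi\<^sub>M I (\<lambda>_. borel)) (\<lambda>\<omega>. \<lambda>i\<in>I. X i \<omega>))"

definition partial_prod :: "(nat \<Rightarrow> 'a \<Rightarrow> real) \<Rightarrow> nat \<Rightarrow> 'a \<Rightarrow> real" where
  "partial_prod X n \<omega> = (\<Prod>k=1..n. X k \<omega>)"

definition expi2 :: "int \<Rightarrow> real \<Rightarrow> complex" where
  "expi2 h x = exp (2 * \<i> * of_real pi * of_int h * of_real x)"

end

theory Submission
  imports Defs
begin

text \<open>
  Write \<open>S l\<close> for the sum of the first \<open>l\<close> logarithms \<open>log b (X i)\<close>, so that \<open>S l = log b (Y l)\<close>.
  The mantissa of \<open>Y l\<close> is \<open>b\<close> to the power \<open>frac (S l)\<close>, hence a path is Benford exactly when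
  \<open>S l\<close> is equidistributed modulo 1, and by Weyl's criterion exactly when for every \<open>h > 0\<close> the
  mean \<open>A N\<close> of \<open>expi2 h (S l)\<close> over \<open>1 \<le> l \<le> N\<close> tends to 0. There are countably many \<open>h\<close>, so
  it suffices to show for each of them that \<open>A N\<close> tends to 0 almost surely if and only if its
  expectation tends to 0 (\<open>AE_means_tendsto_zero_iff\<close>). One direction is dominated convergence.

  For the other direction, two consequences of stationarity are combined. Write \<open>E\<close> for the
  expectation.

  \<^item> The second moment of \<open>N * A N\<close> grows slowly. Factoring out the first step turns the sum of
  the first \<open>N + 1\<close> terms into a unimodular factor times 1 plus a sum distributed like the
  first \<open>N\<close> terms, so the second moment increases by \<open>1 + 2 * Re (E (N * A N))\<close>, which is
  \<open>o(N)\<close> by hypothesis. Thus \<open>A N\<close> tends to 0 in mean square, and in mean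
  (\<open>second_moment_Suc\<close>, \<open>mean_walk_char_tendsto_L1\<close>).

  \<^item> Convergence in mean becomes convergence almost surely by a maximal inequality. Cut the sum into
  sliding blocks of length \<open>L\<close>: up to an error \<open>2 * L / N\<close>, the modulus of \<open>A N\<close> is at most the
  mean of the moduli \<open>W n\<close> of the block means. The common factor \<open>expi2 h (S n)\<close> drops out of
  \<open>W n\<close>, which therefore depends on the increments only and is stationary, with expectation
  \<open>E \<bar>A L\<bar>\<close>. By the maximal inequality (\<open>maximal_inequality\<close>, derived from Garsia's argument for
  the maximal ergodic theorem), the means of \<open>W\<close> ever exceed \<open>c\<close> with probability at most
  \<open>E \<bar>A L\<bar> / c\<close>. As \<open>L\<close> is arbitrary, \<open>\<bar>A N\<bar> > 2 * c\<close> for infinitely many \<open>N\<close> has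
  probability 0.
\<close>

section \<open>Cesaro means\<close>

lemma sum_1_to_Suc_split_first:
  fixes f :: "nat \<Rightarrow> 'a::comm_monoid_add"
  shows "(\<Sum>n=1..Suc N. f n) = f 1 + (\<Sum>n=1..N. f (n + 1))"
  by (induction N) (auto simp: add_ac)

definition cesaro_mean :: "(nat \<Rightarrow> 'a::real_vector) \<Rightarrow> nat \<Rightarrow> 'a" where
  "cesaro_mean f N = (\<Sum>n=1..N. f n) /\<^sub>R real N"

lemma cesaro_mean_cong: "(\<And>n. n \<ge> 1 \<Longrightarrow> f n = g n) \<Longrightarrow> cesaro_mean f N = cesaro_mean g N"
  unfolding cesaro_mean_def by (intro arg_cong2[where f=scaleR] sum.cong) auto

lemma cesaro_mean_add: "cesaro_mean (\<lambda>n. f n + g n) N = cesaro_mean f N + cesaro_mean g N"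
  by (simp add: cesaro_mean_def sum.distrib scaleR_add_right)

lemma cesaro_mean_diff: "cesaro_mean (\<lambda>n. f n - g n) N = cesaro_mean f N - cesaro_mean g N"
  by (simp add: cesaro_mean_def sum_subtractf scaleR_diff_right)

lemma cesaro_mean_sum: "cesaro_mean (\<lambda>n. \<Sum>j\<in>A. f j n) N = (\<Sum>j\<in>A. cesaro_mean (f j) N)"
  by (simp add: cesaro_mean_def scaleR_sum_right) (rule sum.swap)

lemma cesaro_mean_swap:
  "cesaro_mean (\<lambda>n. cesaro_mean (\<lambda>l. f n l) L) N = cesaro_mean (\<lambda>l. cesaro_mean (\<lambda>n. f n l) N) L"
proof -
  have "cesaro_mean (\<lambda>n. cesaro_mean (\<lambda>l. f n l) L) N =
      (\<Sum>n=1..N. \<Sum>l=1..L. (inverse (real N) * inverse (real L)) *\<^sub>R f n l)"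
    by (simp add: cesaro_mean_def scaleR_sum_right)
  also have "\<dots> = (\<Sum>l=1..L. \<Sum>n=1..N. (inverse (real N) * inverse (real L)) *\<^sub>R f n l)"
    by (rule sum.swap)
  also have "\<dots> = cesaro_mean (\<lambda>l. cesaro_mean (\<lambda>n. f n l) N) L"
    by (simp add: cesaro_mean_def scaleR_sum_right mult.commute)
  finally show ?thesis .
qed

lemma cesaro_mean_bounded_linear:
  "bounded_linear T \<Longrightarrow> cesaro_mean (\<lambda>n. T (f n)) N = T (cesaro_mean f N)"
  by (simp add: cesaro_mean_def linear_sum linear_scale bounded_linear.linear)

lemma cesaro_mean_const: "N \<ge> 1 \<Longrightarrow> cesaro_mean (\<lambda>n. c) N = c"
  by (simp add: cesaro_mean_def sum_constant_scaleR)

lemma tendsto_cesaro_mean_const: "cesaro_mean (\<lambda>n. c) \<longlonglongrightarrow> c"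
  by (rule tendsto_eventually)
    (auto simp: eventually_sequentially cesaro_mean_const intro!: exI[of _ 1])

lemma cesaro_mean_mono:
  fixes f g :: "nat \<Rightarrow> real"
  shows "(\<And>n. n \<ge> 1 \<Longrightarrow> f n \<le> g n) \<Longrightarrow> cesaro_mean f N \<le> cesaro_mean g N"
  unfolding cesaro_mean_def by (intro scaleR_left_mono sum_mono) auto

lemma norm_cesaro_mean_le:
  "norm (cesaro_mean f N) \<le> cesaro_mean (\<lambda>n. norm (f n)) N"
  by (simp add: cesaro_mean_def norm_sum mult_left_mono)

lemma norm_cesaro_mean_le_bound:
  assumes "\<And>n. n \<ge> 1 \<Longrightarrow> norm (f n) \<le> c" and "c \<ge> 0"
  shows "norm (cesaro_mean f N) \<le> c"
proof (cases "N = 0")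
  case False
  have "norm (cesaro_mean f N) \<le> cesaro_mean (\<lambda>n. norm (f n)) N"
    by (rule norm_cesaro_mean_le)
  also have "\<dots> \<le> cesaro_mean (\<lambda>n. c) N"
    by (rule cesaro_mean_mono) (rule assms)
  finally show ?thesis
    using False by (simp add: cesaro_mean_const)
qed (simp add: cesaro_mean_def assms)

text \<open>The limits of Cesaro means are stable under uniform approximation of the sequence. Both halves of
  Weyl's criterion rest on this: a character is approximated by step functions, a continuous
  function by trigonometric polynomials.\<close>

lemma cesaro_mean_tendsto_uniform_approx:
  fixes f :: "nat \<Rightarrow> 'a::real_normed_vector"
  assumes "\<And>\<epsilon>. \<epsilon> > 0 \<Longrightarrow> \<exists>g d. (\<forall>n\<ge>1. norm (f n - g n) \<le> \<epsilon>) \<and> norm (d - c) \<le> \<epsilon> \<and> cesaro_mean g \<longlonglongrightarrow> d"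
  shows "cesaro_mean f \<longlonglongrightarrow> c"
proof (rule LIMSEQ_I)
  fix r :: real assume "r > 0"
  then obtain g d where g: "\<forall>n\<ge>1. norm (f n - g n) \<le> r / 4" "norm (d - c) \<le> r / 4"
      and lim: "cesaro_mean g \<longlonglongrightarrow> d"
    using assms[of "r / 4"] by auto
  obtain no where no: "\<And>N. N \<ge> no \<Longrightarrow> norm (cesaro_mean g N - d) < r / 4"
    using LIMSEQ_D[OF lim, of "r / 4"] \<open>r > 0\<close> by auto
  have "norm (cesaro_mean f N - c) < r" if "N \<ge> no" for N
  proof -
    have "norm (cesaro_mean f N - cesaro_mean g N) \<le> r / 4"
      unfolding cesaro_mean_diff[symmetric]
      by (rule norm_cesaro_mean_le_bound) (use g \<open>r > 0\<close> in auto)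
    then show ?thesis
      using no[OF that] g(2) \<open>r > 0\<close>
        norm_triangle_ineq[of "cesaro_mean f N - cesaro_mean g N" "cesaro_mean g N - d + (d - c)"]
        norm_triangle_ineq[of "cesaro_mean g N - d" "d - c"]
      by simp
  qed
  then show "\<exists>no. \<forall>N\<ge>no. norm (cesaro_mean f N - c) < r"
    by blast
qed

section \<open>The characters of the circle\<close>

lemma norm_expi2 [simp]: "norm (expi2 h x) = 1"
  by (simp add: expi2_def norm_exp_eq_Re)

lemma expi2_eq_cis: "expi2 h x = cis (2 * pi * of_int h * x)"
  by (simp add: expi2_def cis_conv_exp mult_ac)

lemma expi2_add: "expi2 h (x + y) = expi2 h x * expi2 h y"
  by (simp add: expi2_eq_cis cis_mult algebra_simps)

lemma expi2_add_index: "expi2 (h + k) x = expi2 h x * expi2 k x"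
  by (simp add: expi2_eq_cis cis_mult algebra_simps)

lemma expi2_minus_index: "expi2 (- h) x = cnj (expi2 h x)"
  by (simp add: expi2_eq_cis cis_cnj)

lemma expi2_0_index [simp]: "expi2 0 x = 1"
  by (simp add: expi2_def)

lemma expi2_0 [simp]: "expi2 h 0 = 1"
  by (simp add: expi2_def)

lemma expi2_of_int [simp]: "expi2 h (of_int k) = 1"
proof -
  have "expi2 h (of_int k) = cis (2 * pi * of_int (h * k))"
    by (simp add: expi2_eq_cis mult_ac)
  then show ?thesis
    using cis_multiple_2pi[of "of_int (h * k)"] by (metis Ints_of_int)
qed

lemma expi2_frac: "expi2 h (frac x) = expi2 h x"
proof -
  have "expi2 h x = expi2 h (of_int \<lfloor>x\<rfloor> + frac x)"
    by (simp add: frac_def)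
  then show ?thesis
    by (simp add: expi2_add del: of_int_floor_le)
qed

lemma continuous_expi2 [continuous_intros]:
  "continuous_on A f \<Longrightarrow> continuous_on A (\<lambda>t. expi2 h (f t))"
  unfolding expi2_def by (intro continuous_intros)

lemma measurable_expi2 [measurable]: "expi2 h \<in> borel_measurable borel"
  by (intro borel_measurable_continuous_onI continuous_intros)

text \<open>The chord between two points of the circle is at most the arc between them.\<close>

lemma norm_expi2_diff_le: "norm (expi2 h x - expi2 h y) \<le> 2 * pi * \<bar>of_int h\<bar> * \<bar>x - y\<bar>"
proof -
  have "expi2 h x - expi2 h y = expi2 h y * (expi2 h (x - y) - 1)"
    by (simp add: right_diff_distrib flip: expi2_add)
  then have "norm (expi2 h x - expi2 h y) = norm (exp (\<i> * of_real (2 * pi * of_int h * (x - y))) - 1)"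
    by (simp add: norm_mult expi2_def mult_ac)
  also have "\<dots> \<le> \<bar>2 * pi * of_int h * (x - y)\<bar>"
    using abs_sin_x_le_abs_x[of "2 * pi * of_int h * (x - y) / 2"] by (simp only: dist_exp_i_1)
  finally show ?thesis
    by (simp add: abs_mult)
qed

lemma expi2_1_eq_iff: "expi2 1 s = expi2 1 t \<longleftrightarrow> s - t \<in> \<int>"
proof -
  have "expi2 1 s = expi2 1 t \<longleftrightarrow> expi2 1 (s - t) = 1"
    using expi2_add[of 1 "s - t" t] norm_expi2[of 1 t] by (auto simp del: norm_expi2)
  also have "\<dots> \<longleftrightarrow> (\<exists>k::int. 2 * pi * (s - t) = 2 * pi * of_int k)"
    by (auto simp: expi2_def exp_eq_1 mult_ac)
  also have "\<dots> \<longleftrightarrow> s - t \<in> \<int>"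
    by (auto simp: Ints_def)
  finally show ?thesis .
qed

text \<open>The antiderivative is again 1-periodic, so its values at the two ends cancel.\<close>

lemma has_integral_expi2:
  assumes "h \<noteq> 0"
  shows "(expi2 h has_integral 0) {0..1}"
proof -
  define c where "c = 2 * \<i> * of_real pi * of_int h"
  have c: "c \<noteq> 0" "expi2 h = (\<lambda>t. exp (c * of_real t))"
    using assms by (auto simp: c_def expi2_def fun_eq_iff)
  have "((\<lambda>t. exp (c * of_real t)) has_integral exp (c * of_real 1) / c - exp (c * of_real 0) / c) {0..1}"
  proof (rule fundamental_theorem_of_calculus)
    fix t :: real
    have "((\<lambda>z. exp (c * z) / c) has_field_derivative exp (c * of_real t)) (at (of_real t))"
      using c by (auto intro!: derivative_eq_intros)
    then show "((\<lambda>t. exp (c * of_real t) / c) has_vector_derivative exp (c * of_real t)) (at t within {0..1})"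
      by (rule has_vector_derivative_real_field)
  qed simp
  also have "exp (c * of_real 1) = 1"
    using expi2_of_int[of h 1] c by (simp add: fun_eq_iff)
  finally show ?thesis
    using c by simp
qed

section \<open>Weyl's criterion\<close>

text \<open>Half-open intervals starting at 0 suffice, as the interval from \<open>p\<close> to \<open>q\<close> is a difference of two
  of them. The endpoint 1 is excluded to match the range of \<open>a\<close> in the definition of Benford
  sequences; there the frequency is trivially 1.\<close>

definition equidistributed_mod1 :: "(nat \<Rightarrow> real) \<Rightarrow> bool" where
  "equidistributed_mod1 x \<longleftrightarrow>
     (\<forall>a. 0 \<le> a \<and> a < 1 \<longrightarrow> cesaro_mean (\<lambda>n. indicator {..<a} (frac (x n))) \<longlonglongrightarrow> a)"

text \<open>A geometric sum whose ratio is an \<open>m\<close>-th root of unity different from 1.\<close>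

lemma expi2_sum_roots_of_unity:
  assumes "0 < h" "h < int m"
  shows "(\<Sum>j<m. expi2 h (real j / real m)) = 0"
proof -
  define w where "w = expi2 h (1 / real m)"
  have pow: "expi2 h (real j / real m) = w ^ j" for j
  proof (induction j)
    case (Suc j)
    have "expi2 h (real (Suc j) / real m) = expi2 h (real j / real m + 1 / real m)"
      by (simp add: add_divide_distrib add.commute)
    then show ?case
      using Suc by (simp add: expi2_add w_def)
  qed simp
  have "w ^ m = 1"
    using pow[of m] assms expi2_of_int[of h 1] by simp
  moreover have "w \<noteq> 1"
  proof
    assume "w = 1"
    then obtain k :: int where "2 * pi * of_int h * (1 / real m) = 2 * pi * of_int k"
      by (auto simp: w_def expi2_def exp_eq_1 mult_ac)
    then have "real_of_int h = of_int (k * int m)"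
      using assms by (simp add: field_simps)
    then have "h = k * int m"
      by linarith
    then show False
      using assms by (metis dvd_triv_right zdvd_not_zless)
  qed
  ultimately show ?thesis
    unfolding pow by (simp add: sum_gp_strict)
qed

text \<open>Replace \<open>x n\<close> by the left end point of the interval of length \<open>1 / m\<close> that contains its
  fractional part. This changes the character by at most \<open>2 * pi * h / m\<close>. Equidistribution
  gives each of the \<open>m\<close> intervals the limit frequency \<open>1 / m\<close>, so the mean of the modified
  sequence tends to the mean of the character over the \<open>m\<close>-th roots of unity, which vanishes for
  \<open>m > h\<close>.\<close>

lemma equidistributed_imp_exponential_means:
  assumes equi: "equidistributed_mod1 x" and "h > 0"
  shows "cesaro_mean (\<lambda>n. expi2 h (x n)) \<longlonglongrightarrow> 0"
proof (rule cesaro_mean_tendsto_uniform_approx)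
  fix \<epsilon> :: real assume "\<epsilon> > 0"
  obtain m :: nat where m: "real m > max (real_of_int h) (2 * pi * of_int h / \<epsilon>)"
    using reals_Archimedean2 by blast
  then have m0: "m > 0" "h < int m"
    using \<open>h > 0\<close> by (auto intro: gr0I)
  define F :: "real \<Rightarrow> nat \<Rightarrow> real" where "F a n = indicator {..<a} (frac (x n))" for a n
  define g where "g n = (\<Sum>j<m. (F (real (Suc j) / real m) n - F (real j / real m) n) *\<^sub>R
    expi2 h (real j / real m))" for n
  have F_lim: "cesaro_mean (F a) \<longlonglongrightarrow> a" if "0 \<le> a" "a \<le> 1" for a
  proof (cases "a = 1")
    case True
    have "F 1 = (\<lambda>n. 1)"
      by (auto simp: F_def fun_eq_iff frac_lt_1)
    then show ?thesis
      using True tendsto_cesaro_mean_const[of "1::real"] by simp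
  next
    case False
    then show ?thesis
      using equi that unfolding equidistributed_mod1_def F_def by auto
  qed
  have mean: "cesaro_mean g = (\<lambda>N. \<Sum>j<m. (cesaro_mean (F (real (Suc j) / real m)) N -
      cesaro_mean (F (real j / real m)) N) *\<^sub>R expi2 h (real j / real m))"
    unfolding g_def cesaro_mean_sum
    by (simp add: fun_eq_iff cesaro_mean_bounded_linear[OF bounded_linear_scaleR_left] cesaro_mean_diff)
  have "cesaro_mean g \<longlonglongrightarrow> (\<Sum>j<m. (real (Suc j) / real m - real j / real m) *\<^sub>R expi2 h (real j / real m))"
    unfolding mean using m0 by (intro tendsto_intros F_lim) (auto simp: divide_simps)
  also have "(\<Sum>j<m. (real (Suc j) / real m - real j / real m) *\<^sub>R expi2 h (real j / real m)) =
      (1 / real m) *\<^sub>R (\<Sum>j<m. expi2 h (real j / real m))"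
    unfolding scaleR_sum_right by (intro sum.cong refl arg_cong2[where f=scaleR]) (simp add: diff_divide_distrib[symmetric])
  also have "\<dots> = 0"
    using expi2_sum_roots_of_unity[OF \<open>h > 0\<close> m0(2)] by simp
  finally have lim: "cesaro_mean g \<longlonglongrightarrow> 0" .
  have "norm (expi2 h (x n) - g n) \<le> \<epsilon>" for n
  proof -
    define i where "i = nat \<lfloor>real m * frac (x n)\<rfloor>"
    have i: "real i \<le> real m * frac (x n)" "real m * frac (x n) < real i + 1"
      unfolding i_def by (auto simp: of_nat_nat) 
    have "real m * frac (x n) < real m * 1"
      using m0 frac_lt_1[of "x n"] by (intro mult_strict_left_mono) auto
    then have "i < m"
      using i by linarith
    have "F (real (Suc j) / real m) n - F (real j / real m) n = (if j = i then 1 else 0)" for j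
    proof -
      have lt: "frac (x n) < real k / real m \<longleftrightarrow> i < k" for k
      proof -
        have "frac (x n) < real k / real m \<longleftrightarrow> real m * frac (x n) < real k"
          using m0 by (simp add: pos_less_divide_eq mult.commute)
        also have "\<dots> \<longleftrightarrow> i < k"
          using i by linarith
        finally show ?thesis .
      qed
      show ?thesis
        using lt[of "Suc j"] lt[of j] by (auto simp: F_def indicator_def simp del: of_nat_Suc)
    qed
    then have "g n = (\<Sum>j<m. if j = i then expi2 h (real j / real m) else 0)"
      unfolding g_def by (intro sum.cong) auto
    also have "\<dots> = expi2 h (real i / real m)"
      using \<open>i < m\<close> by simp
    finally have "norm (expi2 h (x n) - g n) = norm (expi2 h (frac (x n)) - expi2 h (real i / real m))"
      by (simp add: expi2_frac)
    also have "\<dots> \<le> 2 * pi * \<bar>of_int h\<bar> * \<bar>frac (x n) - real i / real m\<bar>"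
      by (rule norm_expi2_diff_le)
    also have "\<dots> \<le> 2 * pi * \<bar>of_int h\<bar> * (1 / real m)"
    proof (intro mult_left_mono)
      have "real i / real m \<le> frac (x n)" "frac (x n) \<le> real i / real m + 1 / real m"
        using i m0 by (simp_all add: field_simps)
      then show "\<bar>frac (x n) - real i / real m\<bar> \<le> 1 / real m"
        by simp
    qed auto
    also have "\<dots> \<le> \<epsilon>"
      using m m0 \<open>\<epsilon> > 0\<close> \<open>h > 0\<close> by (simp add: field_simps)
    finally show ?thesis .
  qed
  then show "\<exists>g d. (\<forall>n\<ge>1. norm (expi2 h (x n) - g n) \<le> \<epsilon>) \<and> norm (d - 0) \<le> \<epsilon> \<and> cesaro_mean g \<longlonglongrightarrow> d"
    using lim \<open>\<epsilon> > 0\<close> by (intro exI[of _ g] exI[of _ "0::complex"]) auto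
qed

text \<open>Trigonometric polynomials of period 1. Sums of monomials are closed under products, so they include
  the restrictions to the circle of all real polynomials in the real and imaginary parts; the
  Stone--Weierstrass theorem supplies such polynomials as approximations.\<close>

inductive trig_poly :: "(real \<Rightarrow> complex) \<Rightarrow> bool" where
  monomial: "trig_poly (\<lambda>t. c * expi2 h t)"
| add: "trig_poly f \<Longrightarrow> trig_poly g \<Longrightarrow> trig_poly (\<lambda>t. f t + g t)"

lemma trig_poly_mult:
  assumes "trig_poly f" "trig_poly g"
  shows "trig_poly (\<lambda>t. f t * g t)"
  using assms(1)
proof induction
  case (monomial c h)
  show ?case
    using assms(2)
  proof induction
    case (monomial d k)
    have "(\<lambda>t. c * expi2 h t * (d * expi2 k t)) = (\<lambda>t. (c * d) * expi2 (h + k) t)"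
      by (simp add: fun_eq_iff expi2_add_index)
    then show ?case
      by (simp only: trig_poly.monomial)
  next
    case (add f g)
    then show ?case
      by (simp add: distrib_left trig_poly.add)
  qed
next
  case (add f g)
  then show ?case
    by (simp add: distrib_right trig_poly.add)
qed

text \<open>On the unit circle the real and imaginary parts are combinations of \<open>expi2 1\<close> and its conjugate
  \<open>expi2 (-1)\<close>.\<close>

lemma trig_poly_real_polynomial_on_circle:
  "real_polynomial_function p \<Longrightarrow> trig_poly (\<lambda>t. of_real (p (expi2 1 t)))"
proof (induction p rule: real_polynomial_function.induct)
  case (linear f)
  interpret bounded_linear f by fact
  have "f (expi2 1 t) = Re (expi2 1 t) * f 1 + Im (expi2 1 t) * f \<i>" for t
  proof -
    let ?z = "expi2 1 t"
    have "f ?z = f (Re ?z *\<^sub>R 1 + Im ?z *\<^sub>R \<i>)"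
      by (intro arg_cong[where f=f]) (simp add: complex_eq_iff)
    then show ?thesis
      by (simp only: add scale real_scaleR_def)
  qed
  then have "(\<lambda>t. of_real (f (expi2 1 t))) =
      (\<lambda>t. (f 1 - \<i> * f \<i>) / 2 * expi2 1 t + (f 1 + \<i> * f \<i>) / 2 * expi2 (-1) t)"
    by (simp add: fun_eq_iff expi2_minus_index complex_eq_iff field_simps)
  then show ?case
    by (simp only: trig_poly.intros)
next
  case (const c)
  show ?case
    using trig_poly.monomial[of "of_real c" 0] by simp
qed (simp_all add: trig_poly.add trig_poly_mult)

context
  fixes x :: "nat \<Rightarrow> real"
  assumes exponential_means: "\<And>h. h > 0 \<Longrightarrow> cesaro_mean (\<lambda>n. expi2 h (x n)) \<longlonglongrightarrow> 0"
begin

text \<open>For a single monomial this is the hypothesis on the exponential means, since the integral of a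
  nontrivial character over a period is 0; a negative frequency is reduced to a positive one by
  conjugation.\<close>

lemma trig_poly_means:
  "trig_poly f \<Longrightarrow> continuous_on {0..1} f \<and> cesaro_mean (\<lambda>n. f (x n)) \<longlonglongrightarrow> integral {0..1} f"
proof (induction rule: trig_poly.induct)
  case (monomial c h)
  have "cesaro_mean (\<lambda>n. expi2 h (x n)) \<longlonglongrightarrow> integral {0..1} (expi2 h)"
  proof (cases "h = 0")
    case True
    have "expi2 0 = (\<lambda>_. 1)"
      by auto
    then show ?thesis
      using True tendsto_cesaro_mean_const[of "1::complex"] by simp
  next
    case False
    then have "integral {0..1} (expi2 h) = 0"
      by (intro integral_unique has_integral_expi2)
    moreover have "cesaro_mean (\<lambda>n. expi2 h (x n)) \<longlonglongrightarrow> 0"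
    proof (cases "h > 0")
      case False
      then have "(\<lambda>N. cnj (cesaro_mean (\<lambda>n. expi2 (- h) (x n)) N)) \<longlonglongrightarrow> cnj 0"
        using \<open>h \<noteq> 0\<close> by (intro tendsto_intros exponential_means) auto
      then show ?thesis
        by (simp add: expi2_minus_index flip: cesaro_mean_bounded_linear[OF bounded_linear_cnj])
    qed (rule exponential_means)
    ultimately show ?thesis
      by simp
  qed
  then have "(\<lambda>N. c * cesaro_mean (\<lambda>n. expi2 h (x n)) N) \<longlonglongrightarrow> c * integral {0..1} (expi2 h)"
    by (intro tendsto_intros)
  then show ?case
    by (auto simp: integral_mult_right intro!: continuous_intros
        simp flip: cesaro_mean_bounded_linear[OF bounded_linear_mult_right])
next
  case (add f g)
  then have "(\<lambda>N. cesaro_mean (\<lambda>n. f (x n)) N + cesaro_mean (\<lambda>n. g (x n)) N) \<longlonglongrightarrow>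
      integral {0..1} f + integral {0..1} g"
    by (intro tendsto_intros) auto
  then show ?case
    using add.IH
    by (auto simp: integral_add integrable_continuous_real intro!: continuous_intros simp flip: cesaro_mean_add)
qed

text \<open>Trigonometric polynomials approximate \<open>\<phi>\<close> uniformly, and their means converge to their integrals.
  The means and the integral of \<open>\<phi>\<close> are then both off by at most the approximation error.\<close>

lemma continuous_on_circle_means:
  fixes \<phi> :: "complex \<Rightarrow> real"
  assumes "continuous_on (sphere 0 1) \<phi>"
  shows "cesaro_mean (\<lambda>n. \<phi> (expi2 1 (x n))) \<longlonglongrightarrow> integral {0..1} (\<lambda>t. \<phi> (expi2 1 t))"
proof -
  have cont: "continuous_on {0..1} (\<lambda>t. complex_of_real (\<phi> (expi2 1 t)))"
    by (intro continuous_intros continuous_on_compose2[OF assms]) auto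
  have "cesaro_mean (\<lambda>n. complex_of_real (\<phi> (expi2 1 (x n)))) \<longlonglongrightarrow>
      integral {0..1} (\<lambda>t. complex_of_real (\<phi> (expi2 1 t)))"
  proof (rule cesaro_mean_tendsto_uniform_approx)
    fix \<epsilon> :: real assume "\<epsilon> > 0"
    obtain p where p: "real_polynomial_function p" "\<And>z. z \<in> sphere 0 1 \<Longrightarrow> \<bar>\<phi> z - p z\<bar> < \<epsilon>"
      using Stone_Weierstrass_real_polynomial_function[OF compact_sphere assms \<open>\<epsilon> > 0\<close>] by blast
    define g where "g t = complex_of_real (p (expi2 1 t))" for t
    have close: "norm (complex_of_real (\<phi> (expi2 1 t)) - g t) \<le> \<epsilon>" for t
      using p(2)[of "expi2 1 t"] by (simp add: g_def flip: of_real_diff)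
    have g: "continuous_on {0..1} g" "cesaro_mean (\<lambda>n. g (x n)) \<longlonglongrightarrow> integral {0..1} g"
      using trig_poly_means[OF trig_poly_real_polynomial_on_circle[OF p(1)]] unfolding g_def by auto
    have "norm (integral {0..1} g - integral {0..1} (\<lambda>t. complex_of_real (\<phi> (expi2 1 t)))) =
        norm (integral {0..1} (\<lambda>t. g t - complex_of_real (\<phi> (expi2 1 t))))"
      using g cont by (simp add: integral_diff integrable_continuous_real)
    also have "\<dots> \<le> \<epsilon> * (1 - 0)"
      using close g cont
      by (intro integral_bound) (auto intro!: continuous_intros simp: norm_minus_commute)
    finally show "\<exists>g d. (\<forall>n\<ge>1. norm (complex_of_real (\<phi> (expi2 1 (x n))) - g n) \<le> \<epsilon>) \<and>
        norm (d - integral {0..1} (\<lambda>t. complex_of_real (\<phi> (expi2 1 t)))) \<le> \<epsilon> \<and> cesaro_mean g \<longlonglongrightarrow> d"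
      using close g(2) by (intro exI[of _ "\<lambda>n. g (x n)"] exI[of _ "integral {0..1} g"]) auto
  qed
  then have "(\<lambda>N. Re (cesaro_mean (\<lambda>n. complex_of_real (\<phi> (expi2 1 (x n)))) N)) \<longlonglongrightarrow>
      Re (integral {0..1} (\<lambda>t. complex_of_real (\<phi> (expi2 1 t))))"
    by (rule tendsto_Re)
  then show ?thesis
    using integral_linear[OF integrable_continuous_real[OF cont] bounded_linear_Re]
    by (simp add: o_def flip: cesaro_mean_bounded_linear[OF bounded_linear_Re])
qed

text \<open>The indicator of a closed set is the decreasing limit of the continuous functions
  \<open>max 0 (1 - k * infdist z K)\<close>. One of them has an integral below \<open>r\<close>, and its means dominate the
  frequency of visits to \<open>K\<close>. Only upper bounds are obtained in this way; lower bounds come from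
  complementary arcs.\<close>

lemma closed_set_means_less:
  assumes K: "closed K" "K \<noteq> {}"
    and int: "((\<lambda>t. indicator K (expi2 1 t) :: real) has_integral \<kappa>) {0..1}" and "\<kappa> < r"
  shows "eventually (\<lambda>N. cesaro_mean (\<lambda>n. indicator K (expi2 1 (x n))) N < r) sequentially"
proof -
  define G where "G k z = max 0 (1 - real k * infdist z K)" for k z
  have cont: "continuous_on A (G k)" for A k
    unfolding G_def by (intro continuous_intros)
  have "(\<lambda>k. G k z) \<longlonglongrightarrow> indicator K z" for z
  proof (cases "z \<in> K")
    case True
    then show ?thesis
      by (simp add: G_def)
  next
    case False
    then have pos: "infdist z K > 0"
      using K in_closed_iff_infdist_zero infdist_nonneg[of z K] by force
    obtain k0 :: nat where "real k0 > 1 / infdist z K"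
      using reals_Archimedean2 by blast
    then have k0: "1 < real k0 * infdist z K"
      using pos by (simp add: field_simps)
    have "G k z = 0" if "k \<ge> k0" for k
    proof -
      have "real k0 * infdist z K \<le> real k * infdist z K"
        using that pos by (intro mult_right_mono) auto
      then show ?thesis
        using k0 by (simp add: G_def)
    qed
    then have "eventually (\<lambda>k. G k z = indicator K z) sequentially"
      using False by (auto simp: eventually_sequentially)
    then show ?thesis
      by (rule tendsto_eventually)
  qed
  then have "(\<lambda>k. integral {0..1} (\<lambda>t. G k (expi2 1 t))) \<longlonglongrightarrow>
      integral {0..1} (\<lambda>t. indicator K (expi2 1 t) :: real)"
    by (intro dominated_convergence(2)[where h="\<lambda>_. 1"] integrable_continuous_real
        continuous_on_compose2[OF cont] continuous_intros)
      (auto simp: G_def infdist_nonneg)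
  then have "(\<lambda>k. integral {0..1} (\<lambda>t. G k (expi2 1 t))) \<longlonglongrightarrow> \<kappa>"
    using integral_unique[OF int] by simp
  then have "eventually (\<lambda>k. integral {0..1} (\<lambda>t. G k (expi2 1 t)) < r) sequentially"
    using \<open>\<kappa> < r\<close> by (rule order_tendstoD)
  then obtain k where "integral {0..1} (\<lambda>t. G k (expi2 1 t)) < r"
    by (auto simp: eventually_sequentially)
  then have "eventually (\<lambda>N. cesaro_mean (\<lambda>n. G k (expi2 1 (x n))) N < r) sequentially"
    by (rule order_tendstoD(2)[OF continuous_on_circle_means[OF cont]])
  moreover have "indicator K z \<le> G k z" for z
    by (auto simp: G_def indicator_def)
  then have "cesaro_mean (\<lambda>n. indicator K (expi2 1 (x n))) N \<le> cesaro_mean (\<lambda>n. G k (expi2 1 (x n))) N" for N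
    by (intro cesaro_mean_mono)
  ultimately show ?thesis
    by (auto elim!: eventually_mono intro: le_less_trans)
qed

lemma arc_means_less:
  assumes "0 \<le> p" "p \<le> q" "q \<le> 1" "q - p < r"
  shows "eventually (\<lambda>N. cesaro_mean (\<lambda>n. indicator {p..q} (frac (x n))) N < r) sequentially"
proof -
  define K where "K = expi2 1 ` {p..q}"
  have "((\<lambda>t. 1::real) has_integral (q - p)) {p..q}"
    using has_integral_const_real[of "1::real" p q] assms by simp
  then have "((\<lambda>t. if t \<in> {p..q} then 1 else 0::real) has_integral (q - p)) {0..1}"
    using assms by (subst has_integral_restrict) auto
  then have int: "((\<lambda>t. indicator K (expi2 1 t) :: real) has_integral (q - p)) {0..1}"
  proof (rule has_integral_spike_finite[rotated 2, of _ _ _ "{0,1}"])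
    \<comment> \<open>The points 0 and 1 are the same point of the circle; away from them, being in the
      arc is being in the interval.\<close>
    fix t :: real assume t: "t \<in> {0..1} - {0, 1}"
    have "t = s" if "s \<in> {p..q}" "t - s \<in> \<int>" for s
    proof -
      obtain k :: int where "t - s = of_int k"
        using \<open>t - s \<in> \<int>\<close> by (rule Ints_cases)
      moreover from this have "\<bar>real_of_int k\<bar> < 1"
        using t that assms by auto
      ultimately show ?thesis
        by (simp flip: of_int_abs)
    qed
    then have "expi2 1 t \<in> K \<longleftrightarrow> t \<in> {p..q}"
      unfolding K_def image_iff expi2_1_eq_iff by (metis Ints_0 diff_self)
    then show "indicator K (expi2 1 t) = (if t \<in> {p..q} then 1 else 0::real)"
      by (simp add: indicator_def)
  qed auto
  have "closed K" "K \<noteq> {}"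
    using assms
    by (auto simp: K_def intro!: compact_imp_closed compact_continuous_image continuous_intros)
  from closed_set_means_less[OF this int \<open>q - p < r\<close>]
  have "eventually (\<lambda>N. cesaro_mean (\<lambda>n. indicator K (expi2 1 (x n))) N < r) sequentially" .
  moreover have "indicator {p..q} (frac s) \<le> (indicator K (expi2 1 s) :: real)" for s
    using expi2_frac[of 1 s] by (auto simp: K_def indicator_def image_iff intro!: bexI[of _ "frac s"])
  then have "cesaro_mean (\<lambda>n. indicator {p..q} (frac (x n))) N \<le>
      (cesaro_mean (\<lambda>n. indicator K (expi2 1 (x n))) N :: real)" for N
    by (intro cesaro_mean_mono)
  ultimately show ?thesis
    by (auto elim!: eventually_mono intro: le_less_trans)
qed

text \<open>The upper bound for the frequency of \<open>{..<a}\<close> comes from the arc \<open>{0..a}\<close>, and the lower bound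
  from the upper bound for the complementary arc \<open>{a..1}\<close>.\<close>

lemma exponential_means_imp_equidistributed: "equidistributed_mod1 x"
  unfolding equidistributed_mod1_def
proof (intro allI impI order_tendstoI)
  fix a r :: real assume a: "0 \<le> a \<and> a < 1" and "a < r"
  have le: "cesaro_mean (\<lambda>n. indicator {..<a} (frac (x n))) N \<le>
      (cesaro_mean (\<lambda>n. indicator {0..a} (frac (x n))) N :: real)" for N
    by (intro cesaro_mean_mono) (auto simp: indicator_def)
  show "eventually (\<lambda>N. cesaro_mean (\<lambda>n. indicator {..<a} (frac (x n))) N < r) sequentially"
    using arc_means_less[of 0 a r] a \<open>a < r\<close>
    by (auto elim!: eventually_mono intro: le_less_trans[OF le])
next
  fix a r :: real assume a: "0 \<le> a \<and> a < 1" and "r < a"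
  have "cesaro_mean (\<lambda>n. indicator {..<a} (frac (x n))) N =
      1 - (cesaro_mean (\<lambda>n. indicator {a..1} (frac (x n))) N :: real)" if "N \<ge> 1" for N
  proof -
    have "indicator {..<a} (frac s) = 1 - (indicator {a..1} (frac s) :: real)" for s
      using frac_lt_1[of s] by (auto simp: indicator_def)
    then show ?thesis
      using that by (simp add: cesaro_mean_diff cesaro_mean_const)
  qed
  moreover have "eventually (\<lambda>N. cesaro_mean (\<lambda>n. indicator {a..1} (frac (x n))) N < 1 - r) sequentially"
    using arc_means_less[of a 1 "1 - r"] a \<open>r < a\<close> by auto
  then have "eventually (\<lambda>N. N \<ge> 1 \<and> cesaro_mean (\<lambda>n. indicator {a..1} (frac (x n))) N < 1 - r) sequentially"
    using eventually_ge_at_top[of 1] by eventually_elim auto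
  ultimately show "eventually (\<lambda>N. cesaro_mean (\<lambda>n. indicator {..<a} (frac (x n))) N > r) sequentially"
    by (auto elim!: eventually_mono)
qed

end

theorem weyl_criterion:
  "equidistributed_mod1 x \<longleftrightarrow> (\<forall>h>0. cesaro_mean (\<lambda>n. expi2 h (x n)) \<longlonglongrightarrow> 0)"
  using equidistributed_imp_exponential_means exponential_means_imp_equidistributed by blast

section \<open>Benford's law as equidistribution of logarithms\<close>

lemma mantissa_eq_powr_frac:
  assumes "b > 1" "x > 0"
  shows "mantissa b x = b powr frac (log b x)"
  unfolding mantissa_def
proof (rule the_equality)
  have "x = b powr (frac (log b x) + of_int \<lfloor>log b x\<rfloor>)"
    using assms by (simp add: frac_def)
  also have "\<dots> = b powr frac (log b x) * b powi \<lfloor>log b x\<rfloor>"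
    using assms by (simp add: powr_add powr_real_of_int')
  finally have "\<exists>k::int. x = b powr frac (log b x) * b powi k"
    by blast
  moreover have "b powr frac (log b x) < b powr 1"
    using assms frac_lt_1[of "log b x"] by (intro powr_less_mono) auto
  ultimately show "1 \<le> b powr frac (log b x) \<and> b powr frac (log b x) < b \<and>
      (\<exists>k::int. x = b powr frac (log b x) * b powi k)"
    using assms by (auto simp: ge_one_powr_ge_zero)
next
  fix m assume m: "1 \<le> m \<and> m < b \<and> (\<exists>k::int. x = m * b powi k)"
  then obtain k :: int where k: "x = m * b powr of_int k"
    using assms by (auto simp: powr_real_of_int')
  have "log b x = log b m + of_int k"
    unfolding k using m assms by (simp add: log_mult_pos)
  then have "frac (log b x) = log b m"
    using m assms by (auto simp: frac_unique_iff log_less_iff[of b m] zero_le_log_cancel_iff)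
  then show "m = b powr frac (log b x)"
    using m assms by simp
qed

lemma benford_iff_equidistributed:
  assumes "b > 1" "\<And>n. n \<ge> 1 \<Longrightarrow> u n > 0"
  shows "benford b u \<longleftrightarrow> equidistributed_mod1 (\<lambda>n. log b (u n))"
proof -
  have mean: "1 / real N * (\<Sum>n=1..N. indicator {1..<a} (mantissa b (u n))) =
      cesaro_mean (\<lambda>n. indicator {..<log b a} (frac (log b (u n)))) N" if "1 \<le> a" for a N
  proof -
    have "indicator {1..<a} (mantissa b (u n)) =
        (indicator {..<log b a} (frac (log b (u n))) :: real)"
      if "n \<ge> 1" for n
      using assms(1) assms(2)[OF that] \<open>1 \<le> a\<close>
      by (auto simp: mantissa_eq_powr_frac indicator_def less_log_iff ge_one_powr_ge_zero)
    then have "cesaro_mean (\<lambda>n. indicator {1..<a} (mantissa b (u n))) N =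
        (cesaro_mean (\<lambda>n. indicator {..<log b a} (frac (log b (u n)))) N :: real)"
      by (rule cesaro_mean_cong)
    then show ?thesis
      by (simp add: cesaro_mean_def divide_inverse)
  qed
  have "benford b u \<longleftrightarrow> (\<forall>a. 1 \<le> a \<and> a < b \<longrightarrow>
      cesaro_mean (\<lambda>n. indicator {..<log b a} (frac (log b (u n)))) \<longlonglongrightarrow> log b a)"
    unfolding benford_def using assms(2) mean by (auto cong: conj_cong)
  also have "\<dots> \<longleftrightarrow> equidistributed_mod1 (\<lambda>n. log b (u n))"
    unfolding equidistributed_mod1_def
  proof (intro iffI allI impI)
    fix a :: real assume *: "\<forall>a. 1 \<le> a \<and> a < b \<longrightarrow>
      cesaro_mean (\<lambda>n. indicator {..<log b a} (frac (log b (u n)))) \<longlonglongrightarrow> log b a" and "0 \<le> a \<and> a < 1"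
    then have "1 \<le> b powr a" "b powr a < b"
      using assms(1) powr_less_mono[of a 1 b] by (auto simp: ge_one_powr_ge_zero)
    with *[rule_format, of "b powr a"] 
    show "cesaro_mean (\<lambda>n. indicator {..<a} (frac (log b (u n)))) \<longlonglongrightarrow> a"
      using assms(1) by simp
  next
    fix a :: real assume *: "\<forall>a. 0 \<le> a \<and> a < 1 \<longrightarrow>
      cesaro_mean (\<lambda>n. indicator {..<a} (frac (log b (u n)))) \<longlonglongrightarrow> a" and "1 \<le> a \<and> a < b"
    then show "cesaro_mean (\<lambda>n. indicator {..<log b a} (frac (log b (u n)))) \<longlonglongrightarrow> log b a"
      using assms(1) by auto
  qed
  finally show ?thesis .
qed

section \<open>Stationary sequences and the maximal ergodic inequality\<close>

text \<open>Expectations of functionals of finitely many terms are shift-invariant. Restricting the argument to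
  \<open>I\<close> makes it a point of the finite product space.\<close>

lemma stationary_integral:
  fixes G :: "(nat \<Rightarrow> real) \<Rightarrow> 'b::{banach, second_countable_topology}"
  assumes "stationary M X" and meas: "\<And>n. n \<ge> 1 \<Longrightarrow> X n \<in> borel_measurable M"
    and I: "finite I" "I \<subseteq> {1..}" and G: "G \<in> borel_measurable (Pi\<^sub>M I (\<lambda>_. borel))"
  shows "(\<integral>\<omega>. G (\<lambda>i\<in>I. X (i + s) \<omega>) \<partial>M) = (\<integral>\<omega>. G (\<lambda>i\<in>I. X i \<omega>) \<partial>M)"
proof -
  have m: "(\<lambda>\<omega>. \<lambda>i\<in>I. X (i + s) \<omega>) \<in> measurable M (Pi\<^sub>M I (\<lambda>_. borel))" for s
    using I by (intro measurable_restrict meas) auto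
  have "(\<integral>\<omega>. G (\<lambda>i\<in>I. X (i + s) \<omega>) \<partial>M) =
      integral\<^sup>L (distr M (Pi\<^sub>M I (\<lambda>_. borel)) (\<lambda>\<omega>. \<lambda>i\<in>I. X (i + s) \<omega>)) G"
    by (rule integral_distr[symmetric, OF m G])
  also have "\<dots> = integral\<^sup>L (distr M (Pi\<^sub>M I (\<lambda>_. borel)) (\<lambda>\<omega>. \<lambda>i\<in>I. X (i + 0) \<omega>)) G"
    using assms(1) I unfolding stationary_def by auto
  also have "\<dots> = (\<integral>\<omega>. G (\<lambda>i\<in>I. X (i + 0) \<omega>) \<partial>M)"
    by (rule integral_distr[OF m G])
  finally show ?thesis
    by simp
qed

text \<open>A function of a sliding window of a stationary sequence is stationary: a finite family of windows
  involves only finitely many terms of \<open>X\<close>, whose joint law is shift-invariant.\<close>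

lemma stationary_sliding_block:
  assumes "stationary M X" and meas: "\<And>n. n \<ge> 1 \<Longrightarrow> X n \<in> borel_measurable M"
    and g: "g \<in> borel_measurable (Pi\<^sub>M {..L} (\<lambda>_. borel))"
  shows "stationary M (\<lambda>n \<omega>. g (\<lambda>l\<in>{..L}. X (n + l) \<omega>))"
  unfolding stationary_def
proof (intro allI impI)
  fix I :: "nat set" and s :: nat assume I: "finite I \<and> I \<subseteq> {1..}"
  define J where "J = (\<Union>i\<in>I. (+) i ` {..L})"
  have J: "finite J" "J \<subseteq> {1..}"
    using I by (auto simp: J_def)
  have inJ: "i + l \<in> J" if "i \<in> I" "l \<le> L" for i l
    using that by (auto simp: J_def)
  define \<Phi> :: "(nat \<Rightarrow> real) \<Rightarrow> nat \<Rightarrow> real" where "\<Phi> \<xi> = (\<lambda>i\<in>I. g (\<lambda>l\<in>{..L}. \<xi> (i + l)))" for \<xi>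
  have \<Phi>: "\<Phi> \<in> measurable (Pi\<^sub>M J (\<lambda>_. borel)) (Pi\<^sub>M I (\<lambda>_. borel))"
    unfolding \<Phi>_def
    by (intro measurable_restrict measurable_compose[OF _ g] measurable_component_singleton inJ) auto
  have m: "(\<lambda>\<omega>. \<lambda>j\<in>J. X (j + s) \<omega>) \<in> measurable M (Pi\<^sub>M J (\<lambda>_. borel))" for s
    using J by (intro measurable_restrict meas) auto
  have eq: "distr M (Pi\<^sub>M I (\<lambda>_. borel)) (\<lambda>\<omega>. \<lambda>i\<in>I. g (\<lambda>l\<in>{..L}. X (i + s + l) \<omega>)) =
      distr (distr M (Pi\<^sub>M J (\<lambda>_. borel)) (\<lambda>\<omega>. \<lambda>j\<in>J. X (j + s) \<omega>)) (Pi\<^sub>M I (\<lambda>_. borel)) \<Phi>" for s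
  proof -
    have "(\<lambda>i\<in>I. g (\<lambda>l\<in>{..L}. X (i + s + l) \<omega>)) = \<Phi> (\<lambda>j\<in>J. X (j + s) \<omega>)" for \<omega>
      unfolding \<Phi>_def using inJ by (intro restrict_ext arg_cong[where f=g]) (simp add: add_ac)
    then show ?thesis
      by (simp add: distr_distr[OF \<Phi> m] o_def)
  qed
  have "distr M (Pi\<^sub>M J (\<lambda>_. borel)) (\<lambda>\<omega>. \<lambda>j\<in>J. X (j + s) \<omega>) =
      distr M (Pi\<^sub>M J (\<lambda>_. borel)) (\<lambda>\<omega>. \<lambda>j\<in>J. X (j + 0) \<omega>)"
    using assms(1) J unfolding stationary_def by auto
  then show "distr M (Pi\<^sub>M I (\<lambda>_. borel)) (\<lambda>\<omega>. \<lambda>i\<in>I. g (\<lambda>l\<in>{..L}. X (i + s + l) \<omega>)) =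
      distr M (Pi\<^sub>M I (\<lambda>_. borel)) (\<lambda>\<omega>. \<lambda>i\<in>I. g (\<lambda>l\<in>{..L}. X (i + l) \<omega>))"
    using eq[of s] eq[of 0] by simp
qed

text \<open>Garsia's argument. Let \<open>m\<close> be the maximum of the partial sums over \<open>0 \<le> N \<le> K\<close>, including the empty
  sum, and \<open>m'\<close> the same maximum for the shifted sequence. Where \<open>m > 0\<close> the maximum is attained at
  some \<open>N \<ge> 1\<close>, and splitting off the first term gives \<open>m \<le> f 1 + m'\<close>; elsewhere \<open>m = 0 \<le> m'\<close>.
  So \<open>m - m'\<close> is at most \<open>f 1\<close> on the event and at most 0 off it, while its expectation is 0 by
  stationarity.\<close>

lemma (in prob_space) maximal_ergodic_inequality:
  assumes stat: "stationary M f" and int: "\<And>n. n \<ge> 1 \<Longrightarrow> integrable M (f n)"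
  shows "0 \<le> (\<integral>\<omega>. indicator {\<omega>\<in>space M. \<exists>N\<in>{1..K}. (\<Sum>n=1..N. f n \<omega>) > 0} \<omega> * f 1 \<omega> \<partial>M)"
proof -
  define H :: "(nat \<Rightarrow> real) \<Rightarrow> real" where "H \<xi> = (MAX N\<in>{0..K}. \<Sum>n=1..N. \<xi> n)" for \<xi>
  define A where "A = {\<omega>\<in>space M. \<exists>N\<in>{1..K}. (\<Sum>n=1..N. f n \<omega>) > 0}"
  define m m' where "m \<omega> = H (\<lambda>n. f n \<omega>)" and "m' \<omega> = H (\<lambda>n. f (n + 1) \<omega>)" for \<omega>
  have [measurable]: "f n \<in> borel_measurable M" if "n \<ge> 1" for n
    using int[OF that] by (rule borel_measurable_integrable)
  have A [measurable]: "A \<in> sets M"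
    unfolding A_def by measurable
  have H_restrict: "H (\<lambda>n\<in>{1..K}. \<xi> n) = H \<xi>" for \<xi>
    unfolding H_def by (intro arg_cong[where f=Max] image_cong sum.cong) auto
  have H_meas: "H \<in> borel_measurable (Pi\<^sub>M {1..K} (\<lambda>_. borel))"
    unfolding H_def
    by (intro borel_measurable_Max borel_measurable_sum measurable_component_singleton) auto
  have H_ge: "H \<xi> \<ge> (\<Sum>n=1..N. \<xi> n)" if "N \<le> K" for \<xi> N
    unfolding H_def using that by (intro Max_ge) auto
  have H_attained: "\<exists>N\<le>K. H \<xi> = (\<Sum>n=1..N. \<xi> n)" for \<xi>
  proof -
    have "H \<xi> \<in> (\<lambda>N. \<Sum>n=1..N. \<xi> n) ` {0..K}"
      unfolding H_def by (rule Max_in) auto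
    then show ?thesis
      by auto
  qed
  have H_abs: "\<bar>H \<xi>\<bar> \<le> (\<Sum>n=1..K. \<bar>\<xi> n\<bar>)" for \<xi>
  proof -
    obtain N where N: "N \<le> K" "H \<xi> = (\<Sum>n=1..N. \<xi> n)"
      using H_attained by blast
    have "\<bar>H \<xi>\<bar> \<le> (\<Sum>n=1..N. \<bar>\<xi> n\<bar>)"
      unfolding N by (rule sum_abs)
    also have "\<dots> \<le> (\<Sum>n=1..K. \<bar>\<xi> n\<bar>)"
      using N by (intro sum_mono2) auto
    finally show ?thesis .
  qed
  have int_H: "integrable M (\<lambda>\<omega>. H (\<lambda>n. f (n + s) \<omega>))" for s
  proof (rule Bochner_Integration.integrable_bound)
    show "integrable M (\<lambda>\<omega>. \<Sum>n=1..K. \<bar>f (n + s) \<omega>\<bar>)"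
      by (intro Bochner_Integration.integrable_sum integrable_abs int) auto
    show "(\<lambda>\<omega>. H (\<lambda>n. f (n + s) \<omega>)) \<in> borel_measurable M"
      unfolding H_def by (intro borel_measurable_Max borel_measurable_sum) auto
    show "AE \<omega> in M. norm (H (\<lambda>n. f (n + s) \<omega>)) \<le> norm (\<Sum>n=1..K. \<bar>f (n + s) \<omega>\<bar>)"
      using H_abs by (auto intro!: AE_I2 order_trans[OF _ abs_ge_self])
  qed
  have int_m: "integrable M m" "integrable M m'"
    using int_H[of 0] int_H[of 1] by (simp_all add: m_def[abs_def] m'_def[abs_def])
  have "(\<integral>\<omega>. H (\<lambda>n\<in>{1..K}. f (n + 1) \<omega>) \<partial>M) = (\<integral>\<omega>. H (\<lambda>n\<in>{1..K}. f n \<omega>) \<partial>M)"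
    by (rule stationary_integral[OF stat]) (use H_meas in auto)
  then have "integral\<^sup>L M m' = integral\<^sup>L M m"
    by (simp only: H_restrict m_def[abs_def] m'_def[abs_def])
  then have "0 = (\<integral>\<omega>. m \<omega> - m' \<omega> \<partial>M)"
    using int_m by simp
  also have "\<dots> \<le> (\<integral>\<omega>. indicator A \<omega> * f 1 \<omega> \<partial>M)"
  proof (rule integral_mono)
    show "integrable M (\<lambda>\<omega>. indicator A \<omega> * f 1 \<omega>)"
      using integrable_mult_indicator[OF A int[of 1]] by simp
    show "m \<omega> - m' \<omega> \<le> indicator A \<omega> * f 1 \<omega>" if "\<omega> \<in> space M" for \<omega>
    proof -
      obtain N where N: "N \<le> K" "m \<omega> = (\<Sum>n=1..N. f n \<omega>)"
        using H_attained unfolding m_def by blast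
      have m'_ge: "m' \<omega> \<ge> (\<Sum>n=1..N. f (n + 1) \<omega>)" if "N \<le> K" for N
        unfolding m'_def using H_ge[OF that] by simp
      show ?thesis
      proof (cases "\<omega> \<in> A")
        case True
        then obtain N' where N': "N' \<in> {1..K}" "(\<Sum>n=1..N'. f n \<omega>) > 0"
          by (auto simp: A_def)
        have "m \<omega> \<ge> (\<Sum>n=1..N'. f n \<omega>)"
          unfolding m_def using N' by (intro H_ge) auto
        then have "N \<noteq> 0"
          using N' N(2) by (intro notI) auto
        then obtain N0 where N0: "N = Suc N0"
          by (cases N) auto
        have "m \<omega> = f 1 \<omega> + (\<Sum>n=1..N0. f (n + 1) \<omega>)"
          unfolding N(2) N0 by (rule sum_1_to_Suc_split_first)
        also have "\<dots> \<le> f 1 \<omega> + m' \<omega>"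
          using m'_ge[of N0] N(1) N0 by simp
        finally show ?thesis
          using True by simp
      next
        case False
        then have "m \<omega> \<le> 0"
          using N that by (cases "N = 0") (auto simp: A_def not_less)
        then show ?thesis
          using False m'_ge[of 0] by simp
      qed
    qed
  qed (use int_m in auto)
  finally show ?thesis
    unfolding A_def .
qed

text \<open>A mean of \<open>W\<close> exceeds \<open>c\<close> when a partial sum of \<open>W n - c\<close> is positive. The maximal ergodic
  inequality for \<open>W n - c\<close> bounds the probability that this happens for some \<open>N \<le> K\<close>, uniformly
  in \<open>K\<close>; these events increase to the event in question.\<close>

lemma (in prob_space) maximal_inequality:
  assumes stat: "stationary M W" and int: "\<And>n. n \<ge> 1 \<Longrightarrow> integrable M (W n)"
    and nonneg: "\<And>\<omega>. \<omega> \<in> space M \<Longrightarrow> 0 \<le> W 1 \<omega>" and "c > 0"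
  shows "prob {\<omega>\<in>space M. \<exists>N\<ge>1. cesaro_mean (\<lambda>n. W n \<omega>) N > c} \<le> expectation (W 1) / c"
proof -
  have [measurable]: "W n \<in> borel_measurable M" if "n \<ge> 1" for n
    using int[OF that] by (rule borel_measurable_integrable)
  define A where "A K = {\<omega>\<in>space M. \<exists>N\<in>{1..K}. (\<Sum>n=1..N. W n \<omega> - c) > 0}" for K
  have A_sets: "A K \<in> sets M" for K
    unfolding A_def by measurable
  have stat': "stationary M (\<lambda>n \<omega>. W n \<omega> - c)"
  proof -
    \<comment> \<open>A window of length one.\<close>
    have "(\<lambda>\<xi>. \<xi> 0 - c) \<in> borel_measurable (Pi\<^sub>M {..0::nat} (\<lambda>_. borel))"
      by (intro borel_measurable_diff measurable_component_singleton) auto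
    from stationary_sliding_block[OF stat _ this] show ?thesis
      by simp
  qed
  have bound: "prob (A K) \<le> expectation (W 1) / c" for K
  proof -
    have int': "integrable M (\<lambda>\<omega>. indicator (A K) \<omega> * W 1 \<omega>)"
      using integrable_mult_indicator[OF A_sets int[of 1]] by simp
    have "0 \<le> (\<integral>\<omega>. indicator (A K) \<omega> * (W 1 \<omega> - c) \<partial>M)"
      unfolding A_def by (rule maximal_ergodic_inequality[OF stat']) (use int in auto)
    also have "\<dots> = (\<integral>\<omega>. indicator (A K) \<omega> * W 1 \<omega> \<partial>M) - c * prob (A K)"
    proof -
      have "integrable M (\<lambda>\<omega>. indicator (A K) \<omega> * c)"
        using A_sets by (simp add: less_top[symmetric])
      then show ?thesis
        using int' A_sets by (simp add: right_diff_distrib mult.commute[of c])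
    qed
    also have "(\<integral>\<omega>. indicator (A K) \<omega> * W 1 \<omega> \<partial>M) \<le> expectation (W 1)"
      using int' int[of 1] nonneg by (intro integral_mono) (auto simp: indicator_def)
    finally show ?thesis
      using \<open>c > 0\<close> by (simp add: field_simps)
  qed
  have "(\<lambda>K. prob (A K)) \<longlonglongrightarrow> prob (\<Union>K. A K)"
    using A_sets by (intro finite_Lim_measure_incseq) (force simp: A_def incseq_def)+
  then have "prob (\<Union>K. A K) \<le> expectation (W 1) / c"
    by (rule LIMSEQ_le_const2) (use bound in auto)
  also have "(\<Union>K. A K) = {\<omega>\<in>space M. \<exists>N\<ge>1. cesaro_mean (\<lambda>n. W n \<omega>) N > c}"
  proof -
    have "cesaro_mean (\<lambda>n. W n \<omega>) N > c \<longleftrightarrow> (\<Sum>n=1..N. W n \<omega> - c) > 0" if "N \<ge> 1" for N \<omega>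
      using that by (simp add: cesaro_mean_def sum_subtractf field_simps)
    then show ?thesis
      by (fastforce simp: A_def)
  qed
  finally show ?thesis .
qed

section \<open>Block means\<close>

text \<open>Each shift by one replaces a single term of the sum.\<close>

lemma norm_cesaro_mean_shift_diff_le:
  fixes z :: "nat \<Rightarrow> 'a::real_normed_vector"
  assumes z: "\<And>n. n \<ge> 1 \<Longrightarrow> norm (z n) \<le> 1"
  shows "norm (cesaro_mean z N - cesaro_mean (\<lambda>n. z (n + l)) N) \<le> 2 * real l / real N"
proof (induction l)
  case (Suc l)
  have telescope: "(\<Sum>n=1..N. z (n + l) - z (n + Suc l)) = z (1 + l) - z (N + 1 + l)"
    by (induction N) auto
  have "cesaro_mean (\<lambda>n. z (n + l)) N - cesaro_mean (\<lambda>n. z (n + Suc l)) N =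
      (z (1 + l) - z (N + 1 + l)) /\<^sub>R real N"
    unfolding telescope[symmetric] by (simp add: cesaro_mean_def sum_subtractf scaleR_diff_right)
  moreover have "norm (z (1 + l) - z (N + 1 + l)) \<le> 1 + 1"
    by (intro order_trans[OF norm_triangle_ineq4] add_mono z) auto
  ultimately have "norm (cesaro_mean (\<lambda>n. z (n + l)) N - cesaro_mean (\<lambda>n. z (n + Suc l)) N) \<le> 2 / real N"
    by (simp add: divide_inverse mult.commute mult_left_mono)
  then have "norm (cesaro_mean z N - cesaro_mean (\<lambda>n. z (n + Suc l)) N) \<le> 2 * real l / real N + 2 / real N"
    using Suc norm_triangle_ineq[of "cesaro_mean z N - cesaro_mean (\<lambda>n. z (n + l)) N"
        "cesaro_mean (\<lambda>n. z (n + l)) N - cesaro_mean (\<lambda>n. z (n + Suc l)) N"]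
    by simp
  then show ?case
    by (simp add: add_divide_distrib distrib_left add.commute)
qed simp

text \<open>The mean of all \<open>z (n + l)\<close> over \<open>1 \<le> n \<le> N\<close> and \<open>1 \<le> l \<le> L\<close> can be read as a mean of block means
  or as a mean of shifts of the mean of \<open>z\<close>, and a shift by \<open>l \<le> L\<close> changes the latter by at most
  \<open>2 * L / N\<close>.\<close>

lemma norm_cesaro_mean_le_block_means:
  fixes z :: "nat \<Rightarrow> 'a::real_normed_vector"
  assumes z: "\<And>n. n \<ge> 1 \<Longrightarrow> norm (z n) \<le> 1" and "L \<ge> 1"
  shows "norm (cesaro_mean z N) \<le>
    cesaro_mean (\<lambda>n. norm (cesaro_mean (\<lambda>l. z (n + l)) L)) N + 2 * real L / real N"
proof -
  have swap: "cesaro_mean (\<lambda>n. cesaro_mean (\<lambda>l. z (n + l)) L) N =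
      cesaro_mean (\<lambda>l. cesaro_mean (\<lambda>n. z (n + l)) N) L"
    by (rule cesaro_mean_swap)
  \<comment> \<open>Zero beyond \<open>L\<close>, so that one bound covers every index.\<close>
  define d where "d l = (if l \<le> L then cesaro_mean z N - cesaro_mean (\<lambda>n. z (n + l)) N else 0)" for l
  have "cesaro_mean z N - cesaro_mean (\<lambda>n. cesaro_mean (\<lambda>l. z (n + l)) L) N =
      cesaro_mean (\<lambda>l. cesaro_mean z N - cesaro_mean (\<lambda>n. z (n + l)) N) L"
    using \<open>L \<ge> 1\<close> by (simp add: swap cesaro_mean_diff cesaro_mean_const)
  also have "\<dots> = cesaro_mean d L"
    unfolding cesaro_mean_def[of _ L] by (intro arg_cong2[where f=scaleR] sum.cong) (auto simp: d_def)
  also have "norm \<dots> \<le> 2 * real L / real N"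
  proof (rule norm_cesaro_mean_le_bound)
    fix l :: nat
    have "2 * real l / real N \<le> 2 * real L / real N" if "l \<le> L"
      using that by (intro divide_right_mono) auto
    then show "norm (d l) \<le> 2 * real L / real N"
      using norm_cesaro_mean_shift_diff_le[of z N l, OF z] by (auto simp: d_def)
  qed auto
  finally have "norm (cesaro_mean z N - cesaro_mean (\<lambda>n. cesaro_mean (\<lambda>l. z (n + l)) L) N) \<le>
      2 * real L / real N" .
  then show ?thesis
    using norm_cesaro_mean_le[of "\<lambda>n. cesaro_mean (\<lambda>l. z (n + l)) L" N]
      norm_triangle_sub[of "cesaro_mean z N" "cesaro_mean (\<lambda>n. cesaro_mean (\<lambda>l. z (n + l)) L) N"]
    by linarith
qed

text \<open>Past some \<open>m\<close> the increments are at most \<open>\<epsilon> / 2 * N\<close>, so \<open>Q N\<close> is at most a constant plus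
  \<open>\<epsilon> / 2 * N\<^sup>2\<close>.\<close>

lemma tendsto_zero_if_increments_sublinear:
  fixes Q r :: "nat \<Rightarrow> real"
  assumes step: "\<And>N. Q (Suc N) \<le> Q N + r N" and nonneg: "\<And>N. Q N \<ge> 0"
    and r: "(\<lambda>N. r N / real N) \<longlonglongrightarrow> 0"
  shows "(\<lambda>N. Q N / (real N)\<^sup>2) \<longlonglongrightarrow> 0"
proof (rule LIMSEQ_I)
  fix \<epsilon> :: real assume "\<epsilon> > 0"
  then obtain n0 where n0: "\<And>N. N \<ge> n0 \<Longrightarrow> norm (r N / real N - 0) < \<epsilon> / 2"
    using LIMSEQ_D[OF r, of "\<epsilon> / 2"] by auto
  \<comment> \<open>Positive, so that the bound on \<open>r N / real N\<close> can be multiplied by \<open>N\<close>.\<close>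
  define m where "m = Suc n0"
  have r_le: "r N \<le> \<epsilon> / 2 * real N" if "N \<ge> m" for N
    using n0[of N] that by (simp add: m_def abs_less_iff field_simps)
  have bound: "Q (m + k) \<le> Q m + real k * (\<epsilon> / 2 * real (m + k))" for k
  proof (induction k)
    case (Suc k)
    have "Q (m + Suc k) \<le> Q (m + k) + r (m + k)"
      using step[of "m + k"] by simp
    also have "\<dots> \<le> Q m + real k * (\<epsilon> / 2 * real (m + k)) + \<epsilon> / 2 * real (m + k)"
      using Suc r_le[of "m + k"] by simp
    also have "\<dots> = Q m + real (Suc k) * (\<epsilon> / 2 * real (m + k))"
      by (simp add: field_simps)
    also have "\<dots> \<le> Q m + real (Suc k) * (\<epsilon> / 2 * real (m + Suc k))"
      using \<open>\<epsilon> > 0\<close> by (intro add_mono mult_left_mono) auto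
    finally show ?case .
  qed simp
  have Q_le: "Q N \<le> Q m + \<epsilon> / 2 * (real N)\<^sup>2" if "N \<ge> m" for N
  proof -
    have "Q N \<le> Q m + real (N - m) * (\<epsilon> / 2 * real N)"
      using bound[of "N - m"] that by simp
    also have "\<dots> \<le> Q m + real N * (\<epsilon> / 2 * real N)"
      using \<open>\<epsilon> > 0\<close> by (intro add_mono mult_right_mono) auto
    finally show ?thesis
      by (simp add: power2_eq_square mult_ac)
  qed
  have "(\<lambda>N. Q m / (real N)\<^sup>2) \<longlonglongrightarrow> 0"
    using tendsto_mult[OF lim_const_over_n[of "Q m"] lim_const_over_n[of "1::real"]]
    by (simp add: power2_eq_square)
  then obtain n1 where n1: "\<And>N. N \<ge> n1 \<Longrightarrow> norm (Q m / (real N)\<^sup>2 - 0) < \<epsilon> / 2"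
    using LIMSEQ_D[of "\<lambda>N. Q m / (real N)\<^sup>2" 0 "\<epsilon> / 2"] \<open>\<epsilon> > 0\<close> by auto
  have "norm (Q N / (real N)\<^sup>2 - 0) < \<epsilon>" if "N \<ge> max m n1" for N
  proof -
    have "N > 0"
      using that by (auto simp: m_def)
    have "Q N / (real N)\<^sup>2 \<le> (Q m + \<epsilon> / 2 * (real N)\<^sup>2) / (real N)\<^sup>2"
      using Q_le that by (intro divide_right_mono) auto
    also have "\<dots> = Q m / (real N)\<^sup>2 + \<epsilon> / 2"
      using \<open>N > 0\<close> by (simp add: field_simps)
    also have "\<dots> < \<epsilon>"
    proof -
      have "norm (Q m / (real N)\<^sup>2 - 0) < \<epsilon> / 2"
        by (rule n1) (use that in simp)
      then show ?thesis
        unfolding real_norm_def by linarith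
    qed
    finally show ?thesis
      using nonneg[of N] by simp
  qed
  then show "\<exists>no. \<forall>N\<ge>no. norm (Q N / (real N)\<^sup>2 - 0) < \<epsilon>"
    by blast
qed

section \<open>Random walks with stationary increments\<close>

locale stationary_increments = prob_space M for M :: "'a measure" +
  fixes V :: "nat \<Rightarrow> 'a \<Rightarrow> real"
  assumes V_measurable [measurable]: "\<And>n. n \<ge> 1 \<Longrightarrow> V n \<in> borel_measurable M"
    and V_stationary: "stationary M V"
begin

definition walk_char :: "int \<Rightarrow> nat \<Rightarrow> 'a \<Rightarrow> complex" where
  "walk_char h l \<omega> = expi2 h (\<Sum>i=1..l. V i \<omega>)"

lemma walk_char_measurable [measurable]: "walk_char h l \<in> borel_measurable M"
  unfolding walk_char_def[abs_def] by (intro measurable_compose[OF _ measurable_expi2] borel_measurable_sum) auto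

lemma norm_walk_char [simp]: "norm (walk_char h l \<omega>) = 1"
  by (simp add: walk_char_def)

lemma integrable_walk_char: "integrable M (walk_char h l)"
  by (rule integrable_const_bound[of _ 1]) auto

lemma walk_char_measurable_mean [measurable]:
  "(\<lambda>\<omega>. cesaro_mean (\<lambda>l. walk_char h l \<omega>) N) \<in> borel_measurable M"
  unfolding cesaro_mean_def by measurable

lemma norm_mean_walk_char_le: "norm (cesaro_mean (\<lambda>l. walk_char h l \<omega>) N) \<le> 1"
  by (rule norm_cesaro_mean_le_bound) auto

lemma expectation_mean_walk_char:
  "(\<integral>\<omega>. cesaro_mean (\<lambda>l. walk_char h l \<omega>) N \<partial>M) = cesaro_mean (\<lambda>l. \<integral>\<omega>. walk_char h l \<omega> \<partial>M) N"
  by (simp add: cesaro_mean_def integrable_walk_char)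

definition second_moment :: "int \<Rightarrow> nat \<Rightarrow> real" where
  "second_moment h N = (\<integral>\<omega>. (norm (\<Sum>l=1..N. walk_char h l \<omega>))\<^sup>2 \<partial>M)"

text \<open>The first increment contributes a unimodular factor common to all terms. What remains is 1 plus the
  sum over the walk driven by the shifted increments, which by stationarity may be replaced by the
  original walk; expand the square.\<close>

lemma second_moment_Suc:
  "second_moment h (Suc N) = second_moment h N + (1 + 2 * Re (\<Sum>l=1..N. \<integral>\<omega>. walk_char h l \<omega> \<partial>M))"
proof -
  define E :: "(nat \<Rightarrow> real) \<Rightarrow> complex" where "E \<xi> = (\<Sum>l=1..N. expi2 h (\<Sum>i=1..l. \<xi> i))" for \<xi>
  define G :: "(nat \<Rightarrow> real) \<Rightarrow> real" where "G \<xi> = (norm (1 + E \<xi>))\<^sup>2" for \<xi>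
  have "(\<Sum>i=1..l. (\<lambda>j\<in>{1..N}. \<xi> j) i) = (\<Sum>i=1..l. \<xi> i)" if "l \<le> N" for l and \<xi> :: "nat \<Rightarrow> real"
    using that by (intro sum.cong) auto
  then have G_restrict: "G (\<lambda>i\<in>{1..N}. \<xi> i) = G \<xi>" for \<xi>
    unfolding G_def E_def by (intro arg_cong[where f="\<lambda>y. (norm (1 + y))\<^sup>2"] sum.cong) auto
  have G_meas: "G \<in> borel_measurable (Pi\<^sub>M {1..N} (\<lambda>_. borel))"
  proof -
    have [measurable]: "(\<lambda>\<xi>. expi2 h (\<Sum>i=1..l. \<xi> i)) \<in> borel_measurable (Pi\<^sub>M {1..N} (\<lambda>_. borel))"
      if "l \<in> {1..N}" for l
      using that
      by (intro measurable_compose[OF _ measurable_expi2] borel_measurable_sum measurable_component_singleton) auto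
    show ?thesis
      unfolding G_def[abs_def] E_def by measurable
  qed
  have first_step: "(\<Sum>l=1..Suc N. walk_char h l \<omega>) = expi2 h (V 1 \<omega>) * (1 + E (\<lambda>i. V (i + 1) \<omega>))" for \<omega>
  proof -
    have "walk_char h (Suc l) \<omega> = expi2 h (V 1 \<omega>) * expi2 h (\<Sum>i=1..l. V (i + 1) \<omega>)" for l
      unfolding walk_char_def expi2_add[symmetric]
      by (intro arg_cong[where f="expi2 h"] sum_1_to_Suc_split_first)
    note * = this
    have "walk_char h 1 \<omega> = expi2 h (V 1 \<omega>)"
      by (simp add: walk_char_def)
    then show ?thesis
      unfolding sum_1_to_Suc_split_first using *
      by (simp add: E_def distrib_left sum_distrib_left)
  qed
  have int: "integrable M (\<lambda>\<omega>. \<Sum>l=1..N. walk_char h l \<omega>)"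
    by (intro Bochner_Integration.integrable_sum integrable_walk_char)
  have int2: "integrable M (\<lambda>\<omega>. (norm (\<Sum>l=1..N. walk_char h l \<omega>))\<^sup>2)"
  proof (rule integrable_const_bound[of _ "(real N)\<^sup>2"])
    have "norm (\<Sum>l=1..N. walk_char h l \<omega>) \<le> real N" for \<omega>
      using norm_sum[of "\<lambda>l. walk_char h l \<omega>" "{1..N}"] by simp
    then show "AE \<omega> in M. norm ((norm (\<Sum>l=1..N. walk_char h l \<omega>))\<^sup>2) \<le> (real N)\<^sup>2"
      by (auto intro!: power_mono)
  qed measurable
  have "second_moment h (Suc N) = (\<integral>\<omega>. G (\<lambda>i. V (i + 1) \<omega>) \<partial>M)"
    unfolding second_moment_def first_step G_def norm_mult norm_expi2 by simp
  also have "\<dots> = (\<integral>\<omega>. G (\<lambda>i\<in>{1..N}. V (i + 1) \<omega>) \<partial>M)"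
    unfolding G_restrict ..
  also have "\<dots> = (\<integral>\<omega>. G (\<lambda>i\<in>{1..N}. V i \<omega>) \<partial>M)"
    by (rule stationary_integral[OF V_stationary]) (use G_meas in auto)
  also have "\<dots> = (\<integral>\<omega>. (norm (1 + (\<Sum>l=1..N. walk_char h l \<omega>)))\<^sup>2 \<partial>M)"
    unfolding G_restrict unfolding G_def E_def walk_char_def ..
  also have "\<dots> = (\<integral>\<omega>. (norm (\<Sum>l=1..N. walk_char h l \<omega>))\<^sup>2 + (1 + 2 * Re (\<Sum>l=1..N. walk_char h l \<omega>)) \<partial>M)"
  proof -
    have "(norm (1 + z))\<^sup>2 = (norm z)\<^sup>2 + (1 + 2 * Re z)" for z :: complex
      unfolding cmod_power2 by (simp add: power2_eq_square algebra_simps)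
    then show ?thesis
      by (simp only:)
  qed
  also have "\<dots> = second_moment h N + (1 + 2 * Re (\<integral>\<omega>. (\<Sum>l=1..N. walk_char h l \<omega>) \<partial>M))"
  proof -
    have "integrable M (\<lambda>\<omega>. Re (\<Sum>l=1..N. walk_char h l \<omega>))"
      using int by (rule integrable_Re)
    then show ?thesis
      using int2 integral_Re[OF int] unfolding second_moment_def by (simp add: prob_space)
  qed
  also have "(\<integral>\<omega>. (\<Sum>l=1..N. walk_char h l \<omega>) \<partial>M) = (\<Sum>l=1..N. \<integral>\<omega>. walk_char h l \<omega> \<partial>M)"
    by (intro Bochner_Integration.integral_sum integrable_walk_char)
  finally show ?thesis .
qed

text \<open>The second moment of the mean is \<open>second_moment h N / N\<^sup>2\<close>, and the increments of
  \<open>second_moment\<close> are sublinear by hypothesis. Nonnegativity of the variance passes from the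
  second moment to the first.\<close>

lemma mean_walk_char_tendsto_L1:
  assumes "cesaro_mean (\<lambda>l. \<integral>\<omega>. walk_char h l \<omega> \<partial>M) \<longlonglongrightarrow> 0"
  shows "(\<lambda>N. \<integral>\<omega>. norm (cesaro_mean (\<lambda>l. walk_char h l \<omega>) N) \<partial>M) \<longlonglongrightarrow> 0"
proof -
  let ?s = "\<lambda>N. \<Sum>l=1..N. \<integral>\<omega>. walk_char h l \<omega> \<partial>M"
  have "(\<lambda>N. 1 / real N + 2 * Re (cesaro_mean (\<lambda>l. \<integral>\<omega>. walk_char h l \<omega> \<partial>M) N)) \<longlonglongrightarrow> 0 + 2 * Re 0"
    using assms by (intro tendsto_intros lim_1_over_n) 
  then have "(\<lambda>N. (1 + 2 * Re (?s N)) / real N) \<longlonglongrightarrow> 0"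
    by (simp add: cesaro_mean_def divide_inverse distrib_left mult_ac)
  then have lim: "(\<lambda>N. second_moment h N / (real N)\<^sup>2) \<longlonglongrightarrow> 0"
    by (rule tendsto_zero_if_increments_sublinear[rotated 2])
      (auto simp: second_moment_Suc, auto simp: second_moment_def)
  have "(\<integral>\<omega>. norm (cesaro_mean (\<lambda>l. walk_char h l \<omega>) N) \<partial>M)\<^sup>2 \<le> second_moment h N / (real N)\<^sup>2" for N
  proof -
    let ?Y = "\<lambda>\<omega>. norm (cesaro_mean (\<lambda>l. walk_char h l \<omega>) N)"
    have "integrable M ?Y" "integrable M (\<lambda>\<omega>. (?Y \<omega>)\<^sup>2)"
      using norm_mean_walk_char_le by (auto intro!: integrable_const_bound[of _ 1] simp: power_le_one)
    then have "(\<integral>\<omega>. ?Y \<omega> \<partial>M)\<^sup>2 \<le> (\<integral>\<omega>. (?Y \<omega>)\<^sup>2 \<partial>M)"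
      using variance_eq[of ?Y] variance_positive[of ?Y] by simp
    also have "\<dots> = second_moment h N / (real N)\<^sup>2"
      unfolding second_moment_def cesaro_mean_def
      by (simp add: power_mult_distrib power_inverse divide_inverse mult.commute)
    finally show ?thesis .
  qed
  then have "(\<lambda>N. (\<integral>\<omega>. norm (cesaro_mean (\<lambda>l. walk_char h l \<omega>) N) \<partial>M)\<^sup>2) \<longlonglongrightarrow> 0"
    by (intro tendsto_sandwich[OF _ _ tendsto_const lim]) auto
  then have "(\<lambda>N. sqrt ((\<integral>\<omega>. norm (cesaro_mean (\<lambda>l. walk_char h l \<omega>) N) \<partial>M)\<^sup>2)) \<longlonglongrightarrow> sqrt 0"
    by (rule tendsto_real_sqrt)
  then show ?thesis
    by (simp add: tendsto_rabs_zero_iff)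
qed

text \<open>The left-hand side does not depend on \<open>L\<close>. The sequence \<open>W\<close> is the modulus of the block means of
  length \<open>L\<close>; if the modulus of the mean exceeds \<open>2 * c\<close> for infinitely many \<open>N\<close>, then for one that
  is so large that \<open>2 * L / N < c\<close> the mean of \<open>W\<close> exceeds \<open>c\<close>, which the maximal inequality makes
  unlikely.\<close>

lemma prob_large_means_le:
  assumes "c > 0" "L \<ge> 1"
  shows "prob {\<omega>\<in>space M. \<not> eventually (\<lambda>N. norm (cesaro_mean (\<lambda>l. walk_char h l \<omega>) N) \<le> 2 * c) sequentially} \<le>
    (\<integral>\<omega>. norm (cesaro_mean (\<lambda>l. walk_char h l \<omega>) L) \<partial>M) / c"
proof -
  define g :: "(nat \<Rightarrow> real) \<Rightarrow> real"
    where "g \<xi> = norm (cesaro_mean (\<lambda>l. expi2 h (\<Sum>i=1..l. \<xi> i)) L)" for \<xi>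
  define W where "W n \<omega> = g (\<lambda>i\<in>{..L}. V (n + i) \<omega>)" for n \<omega>
  have g_restrict: "g (\<lambda>i\<in>I. \<xi> i) = g \<xi>" if "{1..L} \<subseteq> I" for \<xi> I
  proof -
    have "(\<Sum>i=1..l. (\<lambda>i\<in>I. \<xi> i) i) = (\<Sum>i=1..l. \<xi> i)" if "l \<le> L" for l
      by (intro sum.cong refl restrict_apply' subsetD[OF \<open>{1..L} \<subseteq> I\<close>]) (use that in auto)
    then show ?thesis
      unfolding g_def cesaro_mean_def by (intro arg_cong[where f="\<lambda>y. norm (y /\<^sub>R real L)"] sum.cong) auto
  qed
  have g_meas: "g \<in> borel_measurable (Pi\<^sub>M I (\<lambda>_. borel))" if "{1..L} \<subseteq> I" for I
  proof -
    have [measurable]: "(\<lambda>\<xi>. expi2 h (\<Sum>i=1..l. \<xi> i)) \<in> borel_measurable (Pi\<^sub>M I (\<lambda>_. borel))"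
      if "l \<in> {1..L}" for l
      using that \<open>{1..L} \<subseteq> I\<close>
      by (intro measurable_compose[OF _ measurable_expi2] borel_measurable_sum measurable_component_singleton) auto
    show ?thesis
      unfolding g_def[abs_def] cesaro_mean_def by measurable
  qed
  \<comment> \<open>The position of the walk at time \<open>n\<close> is a unimodular factor of the whole block.\<close>
  have W_eq: "W n \<omega> = norm (cesaro_mean (\<lambda>l. walk_char h (n + l) \<omega>) L)" for n \<omega>
  proof -
    have "walk_char h (n + l) \<omega> = walk_char h n \<omega> * expi2 h (\<Sum>i=1..l. V (n + i) \<omega>)" for l
    proof -
      have "(\<Sum>i=1..n + l. V i \<omega>) = (\<Sum>i=1..n. V i \<omega>) + (\<Sum>i=1..l. V (n + i) \<omega>)"
        by (induction l) (auto simp: add_ac)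
      then show ?thesis
        by (simp add: walk_char_def expi2_add)
    qed
    then have "cesaro_mean (\<lambda>l. walk_char h (n + l) \<omega>) L =
        walk_char h n \<omega> * cesaro_mean (\<lambda>l. expi2 h (\<Sum>i=1..l. V (n + i) \<omega>)) L"
      by (simp add: cesaro_mean_bounded_linear[OF bounded_linear_mult_right])
    moreover have "W n \<omega> = g (\<lambda>i. V (n + i) \<omega>)"
      unfolding W_def by (rule g_restrict) auto
    ultimately show ?thesis
      by (simp add: g_def norm_mult)
  qed
  have W_int: "integrable M (W n)" for n
  proof (rule integrable_const_bound[of _ 1])
    show "W n \<in> borel_measurable M"
      unfolding W_eq[abs_def] cesaro_mean_def by measurable
    show "AE \<omega> in M. norm (W n \<omega>) \<le> 1"
      by (auto simp: W_eq intro!: norm_cesaro_mean_le_bound)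
  qed
  have W_stat: "stationary M W"
    unfolding W_def[abs_def] by (rule stationary_sliding_block[OF V_stationary V_measurable g_meas]) auto
  have "expectation (W 1) = (\<integral>\<omega>. g (\<lambda>i\<in>{1..L}. V (i + 1) \<omega>) \<partial>M)"
    unfolding W_def by (simp add: g_restrict add.commute)
  also have "\<dots> = (\<integral>\<omega>. g (\<lambda>i\<in>{1..L}. V i \<omega>) \<partial>M)"
    by (rule stationary_integral[OF V_stationary]) (use g_meas in auto)
  also have "\<dots> = (\<integral>\<omega>. norm (cesaro_mean (\<lambda>l. walk_char h l \<omega>) L) \<partial>M)"
    unfolding g_restrict[OF order_refl] unfolding g_def walk_char_def ..
  finally have W_exp: "expectation (W 1) = (\<integral>\<omega>. norm (cesaro_mean (\<lambda>l. walk_char h l \<omega>) L) \<partial>M)" .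
  let ?bad = "{\<omega>\<in>space M. \<exists>N\<ge>1. cesaro_mean (\<lambda>n. W n \<omega>) N > c}"
  have "{\<omega>\<in>space M. \<not> eventually (\<lambda>N. norm (cesaro_mean (\<lambda>l. walk_char h l \<omega>) N) \<le> 2 * c) sequentially} \<subseteq> ?bad"
  proof -
    have "eventually (\<lambda>N. norm (cesaro_mean (\<lambda>l. walk_char h l \<omega>) N) \<le> 2 * c) sequentially"
      if "\<And>N. N \<ge> 1 \<Longrightarrow> cesaro_mean (\<lambda>n. W n \<omega>) N \<le> c" for \<omega>
    proof -
      have "eventually (\<lambda>N. 2 * real L / real N < c) sequentially"
        by (rule order_tendstoD(2)[OF lim_const_over_n \<open>c > 0\<close>])
      then show ?thesis
        using eventually_ge_at_top[of "1::nat"]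
      proof eventually_elim
        case (elim N)
        then show ?case
          using that[of N] norm_cesaro_mean_le_block_means[of "\<lambda>l. walk_char h l \<omega>" L N] \<open>L \<ge> 1\<close>
          by (simp add: W_eq)
      qed
    qed
    then show ?thesis
      by (auto simp: not_less[symmetric])
  qed
  moreover have "?bad \<in> events"
    using W_int[THEN borel_measurable_integrable] unfolding cesaro_mean_def by measurable
  ultimately have "prob {\<omega>\<in>space M. \<not> eventually (\<lambda>N. norm (cesaro_mean (\<lambda>l. walk_char h l \<omega>) N) \<le> 2 * c) sequentially} \<le> prob ?bad"
    by (intro finite_measure_mono)
  also have "\<dots> \<le> expectation (W 1) / c"
    by (rule maximal_inequality[OF W_stat W_int]) (auto simp: W_eq \<open>c > 0\<close>)
  finally show ?thesis
    unfolding W_exp .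
qed

text \<open>From the expectations to the paths: \<open>prob_large_means_le\<close> holds for every \<open>L\<close>, and its right-hand
  side tends to 0 as \<open>L\<close> grows. From the paths to the expectations: dominated convergence.\<close>

theorem AE_means_tendsto_zero_iff:
  "(AE \<omega> in M. cesaro_mean (\<lambda>l. walk_char h l \<omega>) \<longlonglongrightarrow> 0) \<longleftrightarrow>
    cesaro_mean (\<lambda>l. \<integral>\<omega>. walk_char h l \<omega> \<partial>M) \<longlonglongrightarrow> 0"
proof
  assume "AE \<omega> in M. cesaro_mean (\<lambda>l. walk_char h l \<omega>) \<longlonglongrightarrow> 0"
  then have "(\<lambda>N. \<integral>\<omega>. cesaro_mean (\<lambda>l. walk_char h l \<omega>) N \<partial>M) \<longlonglongrightarrow> (\<integral>\<omega>. 0 \<partial>M)"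
    by (intro integral_dominated_convergence[where w="\<lambda>_. 1"]) (auto simp: norm_mean_walk_char_le)
  then show "cesaro_mean (\<lambda>l. \<integral>\<omega>. walk_char h l \<omega> \<partial>M) \<longlonglongrightarrow> 0"
    by (simp add: expectation_mean_walk_char)
next
  assume *: "cesaro_mean (\<lambda>l. \<integral>\<omega>. walk_char h l \<omega> \<partial>M) \<longlonglongrightarrow> 0"
  have small: "AE \<omega> in M. eventually (\<lambda>N. norm (cesaro_mean (\<lambda>l. walk_char h l \<omega>) N) \<le> 2 * c) sequentially"
    if "c > 0" for c
  proof -
    let ?E = "{\<omega>\<in>space M. \<not> eventually (\<lambda>N. norm (cesaro_mean (\<lambda>l. walk_char h l \<omega>) N) \<le> 2 * c) sequentially}"
    have E: "?E \<in> events"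
      unfolding eventually_sequentially by measurable
    have "(\<lambda>L. (\<integral>\<omega>. norm (cesaro_mean (\<lambda>l. walk_char h l \<omega>) L) \<partial>M) / c) \<longlonglongrightarrow> 0 / c"
      using \<open>c > 0\<close> by (intro tendsto_intros mean_walk_char_tendsto_L1 *) auto
    then have "prob ?E \<le> 0 / c"
    proof (rule LIMSEQ_le_const, intro exI allI impI)
      fix L :: nat assume "L \<ge> 1"
      with \<open>c > 0\<close> show "prob ?E \<le> (\<integral>\<omega>. norm (cesaro_mean (\<lambda>l. walk_char h l \<omega>) L) \<partial>M) / c"
        by (rule prob_large_means_le)
    qed
    then have "prob ?E = 0"
      using measure_nonneg[of M ?E] by linarith
    then show ?thesis
      unfolding AE_iff_measurable[OF E refl] by (simp add: emeasure_eq_measure)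
  qed
  have "AE \<omega> in M. \<forall>k::nat. eventually (\<lambda>N. norm (cesaro_mean (\<lambda>l. walk_char h l \<omega>) N) \<le> 2 * (1 / real (Suc k))) sequentially"
    unfolding AE_all_countable by (intro allI small) auto
  then show "AE \<omega> in M. cesaro_mean (\<lambda>l. walk_char h l \<omega>) \<longlonglongrightarrow> 0"
  proof (rule AE_mp[OF _ AE_I2], intro impI tendstoI)
    fix \<omega> and e :: real
    assume ev: "\<forall>k::nat. eventually (\<lambda>N. norm (cesaro_mean (\<lambda>l. walk_char h l \<omega>) N) \<le> 2 * (1 / real (Suc k))) sequentially"
      and "e > 0"
    obtain k where k: "inverse (real (Suc k)) < e / 2"
      using reals_Archimedean[of "e / 2"] \<open>e > 0\<close> by auto
    show "eventually (\<lambda>N. dist (cesaro_mean (\<lambda>l. walk_char h l \<omega>) N) 0 < e) sequentially"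
      using ev[rule_format, of k]
    proof eventually_elim
      case (elim N)
      also have "2 * (1 / real (Suc k)) < e"
        using k by (simp add: inverse_eq_divide)
      finally show ?case
        by simp
    qed
  qed
qed

end

section \<open>Products of stationary sequences\<close>

theorem theorem3p1:
  fixes M :: "'a measure" and X :: "nat \<Rightarrow> 'a \<Rightarrow> real" and b :: real
  assumes "prob_space M"
    and "b > 1"
    and "\<And>n. n \<ge> 1 \<Longrightarrow> X n \<in> borel_measurable M"
    and "\<And>n \<omega>. n \<ge> 1 \<Longrightarrow> \<omega> \<in> space M \<Longrightarrow> X n \<omega> > 0"
    and "stationary M X"
  shows "as_benford M b (partial_prod X) \<longleftrightarrow>
    (\<forall>h::int. h > 0 \<longrightarrow>
      (\<lambda>L. 1 / of_nat L * (\<Sum>l=1..L. \<integral>\<omega>. expi2 h (log b (partial_prod X l \<omega>)) \<partial>M)) \<longlonglongrightarrow> 0)"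
proof -
  interpret prob_space M
    by fact
  define V where "V n \<omega> = log b (X n \<omega>)" for n \<omega>
  interpret stationary_increments M V
  proof
    show "V n \<in> borel_measurable M" if "n \<ge> 1" for n
      unfolding V_def[abs_def] using assms(3)[OF that] by measurable
    have "(\<lambda>\<xi>. log b (\<xi> 0)) \<in> borel_measurable (Pi\<^sub>M {..0::nat} (\<lambda>_. borel))"
      by measurable
    from stationary_sliding_block[OF assms(5,3) this] show "stationary M V"
      by (simp add: V_def[abs_def])
  qed
  have pos: "partial_prod X n \<omega> > 0" if "\<omega> \<in> space M" for n \<omega>
    unfolding partial_prod_def using that assms(4) by (intro prod_pos) auto
  have "log b (partial_prod X l \<omega>) = (\<Sum>i=1..l. V i \<omega>)" if "\<omega> \<in> space M" for l \<omega>
  proof (induction l)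
    case (Suc l)
    have "partial_prod X (Suc l) \<omega> = partial_prod X l \<omega> * X (Suc l) \<omega>"
      by (simp add: partial_prod_def)
    then show ?case
      using Suc pos[OF that] assms(4)[OF _ that, of "Suc l"] by (simp add: V_def log_mult_pos)
  qed (simp add: partial_prod_def)
  then have char: "expi2 h (log b (partial_prod X l \<omega>)) = walk_char h l \<omega>" if "\<omega> \<in> space M" for h l \<omega>
    using that by (simp add: walk_char_def)
  let ?P = "\<lambda>h \<omega>. cesaro_mean (\<lambda>l. walk_char h l \<omega>) \<longlonglongrightarrow> 0"
  have benford: "benford b (\<lambda>n. partial_prod X n \<omega>) \<longleftrightarrow> (\<forall>h>0. ?P h \<omega>)" if "\<omega> \<in> space M" for \<omega>
    using benford_iff_equidistributed[OF assms(2) pos[OF that]] char[OF that]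
    by (simp add: weyl_criterion)
  have P_sets: "{\<omega>\<in>space M. ?P h \<omega>} \<in> events" for h
    by measurable
  then have sets: "{\<omega>\<in>space M. \<forall>h>0. ?P h \<omega>} \<in> events"
    by measurable
  have "as_benford M b (partial_prod X) \<longleftrightarrow> prob {\<omega>\<in>space M. \<forall>h>0. ?P h \<omega>} = 1"
    unfolding as_benford_def using benford by (simp cong: conj_cong)
  also have "\<dots> \<longleftrightarrow> (AE \<omega> in M. \<forall>h>0. ?P h \<omega>)"
    by (rule prob_Collect_eq_1[OF sets])
  also have "\<dots> \<longleftrightarrow> (\<forall>h>0. AE \<omega> in M. ?P h \<omega>)"
  proof -
    have "(AE \<omega> in M. 0 < h \<longrightarrow> ?P h \<omega>) \<longleftrightarrow> (0 < h \<longrightarrow> (AE \<omega> in M. ?P h \<omega>))" for h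
      by (cases "0 < h") auto
    then show ?thesis
      by (simp add: AE_all_countable)
  qed
  also have "\<dots> \<longleftrightarrow> (\<forall>h>0. cesaro_mean (\<lambda>l. \<integral>\<omega>. walk_char h l \<omega> \<partial>M) \<longlonglongrightarrow> 0)"
    by (simp only: AE_means_tendsto_zero_iff)
  also have "(\<lambda>h l. \<integral>\<omega>. walk_char h l \<omega> \<partial>M) = (\<lambda>h l. \<integral>\<omega>. expi2 h (log b (partial_prod X l \<omega>)) \<partial>M)"
    by (intro ext Bochner_Integration.integral_cong) (auto simp: char)
  finally show ?thesis
    by (simp add: cesaro_mean_def[abs_def] scaleR_conv_of_real divide_inverse)
qed

end
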